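(* Let $g \geq 2$ and let $\Gamma_g$ be the fundamental group of a closed orientable surface of genus $g$. There exists a residually nilpotent group $G$ of rank $2g$, not isomorphic to $\Gamma_g$, such that $G/\gamma_i(G) \cong \Gamma_g/\gamma_i(\Gamma_g)$ for all $i \geq 1$.
   Context: The lower central series of a group $G$ is $\gamma_1(G) = G$, $\gamma_k(G) = [G,\gamma_{k-1}(G)]$ for $k\ge 2$. The rank of a group is the minimal size of a generating set. A group is residually nilpotent if $\bigcap_i \gamma_i(G) = 1$. *)

theory Defs
  imports "HOL-Algebra.Algebra"
begin

text \<open>A letter (i, False) stands for the generator x_i, (i, True) for its inverse.\<close>
type_synonym letter = "nat \<times> bool"

definition inv_letter :: "letter \<Rightarrow> letter" where
  "inv_letter x = (fst x, \<not> snd x)"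

definition letters :: "nat \<Rightarrow> letter set" where
  "letters n = {x. fst x < n}"

inductive_set pres_rel :: "nat \<Rightarrow> letter list set \<Rightarrow> (letter list \<times> letter list) set"
  for n :: nat and R :: "letter list set" where
  refl: "w \<in> lists (letters n) \<Longrightarrow> (w, w) \<in> pres_rel n R"
| sym: "(u, v) \<in> pres_rel n R \<Longrightarrow> (v, u) \<in> pres_rel n R"
| trans: "(u, v) \<in> pres_rel n R \<Longrightarrow> (v, w) \<in> pres_rel n R \<Longrightarrow> (u, w) \<in> pres_rel n R"
| cancel: "u \<in> lists (letters n) \<Longrightarrow> v \<in> lists (letters n) \<Longrightarrow> x \<in> letters n \<Longrightarrow>
     (u @ [x, inv_letter x] @ v, u @ v) \<in> pres_rel n R"
| relator: "u \<in> lists (letters n) \<Longrightarrow> v \<in> lists (letters n) \<Longrightarrow> r \<in> R \<Longrightarrow>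
     r \<in> lists (letters n) \<Longrightarrow> (u @ r @ v, u @ v) \<in> pres_rel n R"

definition presented_group :: "nat \<Rightarrow> letter list set \<Rightarrow> letter list set monoid" where
  "presented_group n R =
     \<lparr> carrier = lists (letters n) // pres_rel n R,
       monoid.mult = (\<lambda>A B. \<Union>a\<in>A. \<Union>b\<in>B. pres_rel n R `` {a @ b}),
       monoid.one = pres_rel n R `` {[]} \<rparr>"

text \<open>Surface relator [a_1,b_1]...[a_g,b_g] with a_k = x_(2k), b_k = x_(2k+1).\<close>
definition surface_relator :: "nat \<Rightarrow> letter list" where
  "surface_relator g = concat (map (\<lambda>k. [(2*k, False), (2*k+1, False), (2*k, True), (2*k+1, True)]) [0..<g])"

definition surface_group :: "nat \<Rightarrow> letter list set monoid" where
  "surface_group g = presented_group (2*g) {surface_relator g}"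

text \<open>lower_central G i = \<gamma>_i(G) for i \<ge> 1 (and, by convention, \<gamma>_0 = G).\<close>
fun lower_central :: "('a, 'b) monoid_scheme \<Rightarrow> nat \<Rightarrow> 'a set" where
  "lower_central G 0 = carrier G"
| "lower_central G (Suc k) =
     (if k = 0 then carrier G
      else generate G {x \<otimes>\<^bsub>G\<^esub> y \<otimes>\<^bsub>G\<^esub> inv\<^bsub>G\<^esub> x \<otimes>\<^bsub>G\<^esub> inv\<^bsub>G\<^esub> y | x y.
                         x \<in> carrier G \<and> y \<in> lower_central G k})"

definition residually_nilpotent :: "('a, 'b) monoid_scheme \<Rightarrow> bool" where
  "residually_nilpotent G \<longleftrightarrow> (\<Inter>i\<in>{1..}. lower_central G i) = {\<one>\<^bsub>G\<^esub>}"

definition has_rank :: "('a, 'b) monoid_scheme \<Rightarrow> nat \<Rightarrow> bool" where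
  "has_rank G n \<longleftrightarrow>
     (\<exists>S. S \<subseteq> carrier G \<and> finite S \<and> card S = n \<and> generate G S = carrier G) \<and>
     (\<forall>S. S \<subseteq> carrier G \<and> finite S \<and> generate G S = carrier G \<longrightarrow> n \<le> card S)"

end

theory Submission
  imports Defs
begin

text \<open>
  Let \<open>F\<close> be free of rank \<open>2g\<close>, \<open>r\<close> the surface relator and \<open>R\<close> its normal closure. If an endomorphism \<open>\<phi>\<close>
  of \<open>F\<close> induces the identity on the abelianization, it induces an automorphism of every
  \<open>F/\<gamma>\<^sub>i(F)\<close>; hence \<open>M\<^sub>i = \<phi>(R)\<gamma>\<^sub>i(F)\<close> is normal and \<open>G = F/\<Inter>\<^sub>i M\<^sub>i\<close> is residually nilpotent with
  the same lower central quotients as \<open>F/R = \<Gamma>\<^sub>g\<close>.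

  It remains to choose \<open>\<phi>\<close> such that \<open>G\<close> is not a surface group. The symmetric group \<open>S\<^sub>5\<close> is a
  quotient of \<open>\<Gamma>\<^sub>g\<close>, while \<open>\<phi>(r)\<close> is trivial in \<open>G\<close>; so it suffices that no surjection \<open>F \<rightarrow> S\<^sub>5\<close>
  kills \<open>\<phi>(r)\<close>. In \<open>S\<^sub>5\<close> no nontrivial element commutes with all conjugates of another
  nontrivial element. Therefore kernels of surjections to \<open>S\<^sub>5\<close> behave like prime ideals, and the finitely
  many kernels can be treated one after the other, modifying \<open>\<phi>\<close> by elements of \<open>\<gamma>\<^sub>2(F)\<close> lying in
  all kernels treated before.
\<close>

section \<open>Commutators and the lower central series\<close>

text \<open>Nilpotent quotients cannot tell G from \<Gamma>_g, so the distinguishing invariant must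
  be a quotient that is not nilpotent. As S_5 is finite, only finitely many maps need control, and
  its surjective endomorphisms are injective. Dividing by the whole intersection, and not just by
  the normal closure of \<phi>(r), is what forces residual nilpotence. An isomorphism G ->
  \<Gamma>_g followed by \<Gamma>_g -> S_5 would give a surjection \<rho> of F with
  \<rho>(\<phi>(r)) = 1, and \<rho>(\<phi>(r)) is r evaluated at the \<rho>(u_i), where u_i =
  \<phi>(x_i). So the task is to choose u_i in x_i \<gamma>_2(F) such that r(u) survives in every
  such quotient. The degree 5 serves twice: S_4 fails the commutation property because of its Klein
  four-group, and S_5 is generated by the commuting pairs (12), (34) and (23), (45), which satisfy
  the relator as soon as g \<ge> 2. The rank is read off modulo 2: F, \<Gamma>_g and G all map onto
  (Z/2)^(2g).\<close>

definition commutator :: "('a, 'b) monoid_scheme \<Rightarrow> 'a \<Rightarrow> 'a \<Rightarrow> 'a" where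
  "commutator G x y = x \<otimes>\<^bsub>G\<^esub> y \<otimes>\<^bsub>G\<^esub> inv\<^bsub>G\<^esub> x \<otimes>\<^bsub>G\<^esub> inv\<^bsub>G\<^esub> y"

lemma lower_central_1 [simp]: "lower_central G (Suc 0) = carrier G"
  by simp

lemma lower_central_Suc_Suc:
  "lower_central G (Suc (Suc k)) =
     generate G {commutator G x y | x y. x \<in> carrier G \<and> y \<in> lower_central G (Suc k)}"
  by (simp add: commutator_def)

declare lower_central.simps(2) [simp del]

lemma (in normal) group_hom_rcoset: "group_hom G (G Mod H) (\<lambda>x. H #> x)"
  by (simp add: group_hom_def group_hom_axioms_def factorgroup_is_group r_coset_hom_Mod)

lemma (in normal) rcoset_eq_one_iff: "x \<in> carrier G \<Longrightarrow> H #> x = \<one>\<^bsub>G Mod H\<^esub> \<longleftrightarrow> x \<in> H"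
  by (metis subgroup_axioms subset coset_join1 coset_join2 one_FactGroup)

context group
begin

lemma cancel_inv [simp]:
  assumes "x \<in> carrier G" "y \<in> carrier G"
  shows "x \<otimes> (inv x \<otimes> y) = y" "inv x \<otimes> (x \<otimes> y) = y"
  using assms by (simp_all add: m_assoc [symmetric])

lemma commutator_closed [simp, intro]:
  "x \<in> carrier G \<Longrightarrow> y \<in> carrier G \<Longrightarrow> commutator G x y \<in> carrier G"
  by (simp add: commutator_def)

lemma commutator_eq_one_iff:
  assumes "x \<in> carrier G" "y \<in> carrier G"
  shows "commutator G x y = \<one> \<longleftrightarrow> x \<otimes> y = y \<otimes> x"
proof -
  have "commutator G x y = (x \<otimes> y) \<otimes> inv (y \<otimes> x)"
    using assms by (simp add: commutator_def inv_mult_group m_assoc)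
  thus ?thesis using assms by (metis inv_closed inv_inv inv_equality m_closed r_inv)
qed

lemma commutator_conj:
  assumes "f \<in> carrier G" "x \<in> carrier G" "y \<in> carrier G"
  shows "f \<otimes> commutator G x y \<otimes> inv f = commutator G (f \<otimes> x \<otimes> inv f) (f \<otimes> y \<otimes> inv f)"
  using assms by (simp add: commutator_def inv_mult_group m_assoc)

text \<open>Expanding, [aq, b] = a (q b q^-1) a^-1 b^-1, so the change disappears exactly when q
  centralizes b. One direction discards harmless factors in the lower central series, the other
  detects a change when words are perturbed.\<close>

lemma commutator_eq_left_iff:
  assumes [simp]: "a \<in> carrier G" "b \<in> carrier G" "q \<in> carrier G"
  shows "commutator G (a \<otimes> q) b = commutator G a b \<longleftrightarrow> q \<otimes> b = b \<otimes> q"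
proof -
  have 1: "commutator G (a \<otimes> q) b = a \<otimes> (q \<otimes> b \<otimes> inv q) \<otimes> (inv a \<otimes> inv b)"
    by (simp add: commutator_def inv_mult_group m_assoc)
  have 2: "commutator G a b = a \<otimes> b \<otimes> (inv a \<otimes> inv b)"
    by (simp add: commutator_def inv_mult_group m_assoc)
  have "commutator G (a \<otimes> q) b = commutator G a b \<longleftrightarrow> q \<otimes> b \<otimes> inv q = b"
    unfolding 1 2 by simp
  thus ?thesis by (metis assms(2,3) inv_solve_right' m_closed)
qed

lemma commutator_eq_right_iff:
  assumes [simp]: "a \<in> carrier G" "b \<in> carrier G" "q \<in> carrier G"
  shows "commutator G a (b \<otimes> q) = commutator G a b \<longleftrightarrow> q \<otimes> a = a \<otimes> q"
proof -
  have 1: "commutator G a (b \<otimes> q) = a \<otimes> b \<otimes> (q \<otimes> inv a \<otimes> inv q \<otimes> inv b)"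
    by (simp add: commutator_def inv_mult_group m_assoc)
  have 2: "commutator G a b = a \<otimes> b \<otimes> (inv a \<otimes> inv b)"
    by (simp add: commutator_def inv_mult_group m_assoc)
  have "commutator G a (b \<otimes> q) = commutator G a b \<longleftrightarrow> q \<otimes> inv a \<otimes> inv q = inv a"
    unfolding 1 2 by simp
  also have "\<dots> \<longleftrightarrow> q \<otimes> inv a = inv a \<otimes> q"
    by (metis assms(1,3) inv_closed inv_solve_right' m_closed)
  also have "\<dots> \<longleftrightarrow> q \<otimes> a = a \<otimes> q"
    by (metis assms(1,3) inv_closed inv_comm inv_inv inv_solve_left inv_solve_right m_assoc m_closed)
  finally show ?thesis .
qed

lemma carrier_normal: "carrier G \<lhd> G"
  by (simp add: normal_inv_iff subgroup_self)

lemma lower_central_normal: "lower_central G k \<lhd> G"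
proof (induction k)
  case 0
  then show ?case by (simp add: carrier_normal)
next
  case (Suc k)
  show ?case
  proof (cases k)
    case 0
    then show ?thesis by (simp add: carrier_normal)
  next
    case [simp]: (Suc j)
    interpret L: normal "lower_central G (Suc j)" G using Suc.IH by simp
    show ?thesis unfolding Suc lower_central_Suc_Suc
    proof (rule normal_generateI)
      fix h f assume "h \<in> {commutator G x y | x y. x \<in> carrier G \<and> y \<in> lower_central G (Suc j)}"
        and f: "f \<in> carrier G"
      then obtain x y where *: "h = commutator G x y" "x \<in> carrier G" "y \<in> lower_central G (Suc j)"
        by blast
      hence "f \<otimes> h \<otimes> inv f = commutator G (f \<otimes> x \<otimes> inv f) (f \<otimes> y \<otimes> inv f)"
        using f commutator_conj by simp
      thus "f \<otimes> h \<otimes> inv f \<in> {commutator G x y | x y. x \<in> carrier G \<and> y \<in> lower_central G (Suc j)}"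
        using * f L.inv_op_closed2 by blast
    qed auto
  qed
qed

lemma lower_central_subgroup: "subgroup (lower_central G k) G"
  using lower_central_normal normal_imp_subgroup by blast

lemma lower_central_closed: "x \<in> lower_central G k \<Longrightarrow> x \<in> carrier G"
  by (rule subgroup.mem_carrier [OF lower_central_subgroup])

lemma commutator_in_lower_central:
  "x \<in> carrier G \<Longrightarrow> y \<in> lower_central G (Suc k) \<Longrightarrow>
    commutator G x y \<in> lower_central G (Suc (Suc k))"
  unfolding lower_central_Suc_Suc by (blast intro: generate.incl)

text \<open>Turns membership in \<open>M\<close> into an equation in a quotient, so that congruences
  modulo \<open>M\<close> become calculations without cosets.\<close>

lemma normal_projection:
  assumes "M \<lhd> G"
  obtains H :: "'a set monoid" and p where "group_hom G H p" "p ` carrier G = carrier H"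
    "\<And>x. x \<in> carrier G \<Longrightarrow> p x = \<one>\<^bsub>H\<^esub> \<longleftrightarrow> x \<in> M"
proof
  interpret M: normal M G by fact
  show "group_hom G (G Mod M) (\<lambda>x. M #> x)" by (rule M.group_hom_rcoset)
  show "(\<lambda>x. M #> x) ` carrier G = carrier (G Mod M)" by (simp add: carrier_FactGroup)
  show "M #> x = \<one>\<^bsub>G Mod M\<^esub> \<longleftrightarrow> x \<in> M" if "x \<in> carrier G" for x
    using that by (rule M.rcoset_eq_one_iff)
qed

end

context group_hom
begin

lemma hom_commutator:
  "x \<in> carrier G \<Longrightarrow> y \<in> carrier G \<Longrightarrow> h (commutator G x y) = commutator H (h x) (h y)"
  by (simp add: commutator_def)

lemma hom_eq_iff:
  assumes [simp]: "x \<in> carrier G" "y \<in> carrier G"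
  shows "h x = h y \<longleftrightarrow> h (inv x \<otimes> y) = \<one>\<^bsub>H\<^esub>"
  using H.inv_solve_left [of "\<one>\<^bsub>H\<^esub>" "h x" "h y"] by (simp add: eq_commute)

lemma image_lower_central:
  assumes surj: "h ` carrier G = carrier H"
  shows "h ` lower_central G k = lower_central H k"
proof (induction k)
  case 0
  then show ?case using surj by simp
next
  case (Suc k)
  show ?case
  proof (cases k)
    case 0
    then show ?thesis using surj by simp
  next
    case [simp]: (Suc j)
    let ?A = "{commutator G x y | x y. x \<in> carrier G \<and> y \<in> lower_central G (Suc j)}"
    let ?B = "{commutator H x y | x y. x \<in> carrier H \<and> y \<in> lower_central H (Suc j)}"
    have "h ` ?A = ?B"
    proof
      show "h ` ?A \<subseteq> ?B"
        using Suc.IH surj by (fastforce simp: hom_commutator G.lower_central_closed)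
      show "?B \<subseteq> h ` ?A"
      proof
        fix z assume "z \<in> ?B"
        then obtain x y where "z = commutator H x y" "x \<in> h ` carrier G" "y \<in> h ` lower_central G (Suc j)"
          using Suc.IH surj by auto
        then obtain a b where "z = commutator H (h a) (h b)" "a \<in> carrier G" "b \<in> lower_central G (Suc j)"
          by auto
        thus "z \<in> h ` ?A" by (auto simp: hom_commutator G.lower_central_closed intro!: image_eqI)
      qed
    qed
    moreover have "?A \<subseteq> carrier G" by (auto simp: G.lower_central_closed)
    hence "h ` generate G ?A = generate H (h ` ?A)" by (rule generate_img [symmetric])
    ultimately show ?thesis by (simp only: Suc lower_central_Suc_Suc)
  qed
qed

end

context group
begin

text \<open>By normality [x, y] = (x y x^-1) y^-1 stays in the term that contains y.\<close>

lemma lower_central_Suc_subset: "lower_central G (Suc k) \<subseteq> lower_central G k"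
proof (cases k)
  case (Suc j)
  interpret L: normal "lower_central G (Suc j)" G by (rule lower_central_normal)
  show ?thesis unfolding Suc lower_central_Suc_Suc
  proof (rule generate_subgroup_incl)
    show "{commutator G x y | x y. x \<in> carrier G \<and> y \<in> lower_central G (Suc j)} \<subseteq> lower_central G (Suc j)"
    proof clarify
      fix x y assume "x \<in> carrier G" "y \<in> lower_central G (Suc j)"
      thus "commutator G x y \<in> lower_central G (Suc j)"
        unfolding commutator_def by (intro L.m_closed L.inv_op_closed2 L.m_inv_closed)
    qed
  qed (rule L.subgroup_axioms)
qed simp

text \<open>Conjugation by a and by b multiplies y by central elements c and d. Hence ab and ba both
  conjugate y to dcy, and [a, b] fixes y. This is an elementwise instance of the three subgroups
  lemma.\<close>

lemma commute_commutator:
  assumes [simp]: "a \<in> carrier G" "b \<in> carrier G" "y \<in> carrier G"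
    and a: "\<And>z. z \<in> carrier G \<Longrightarrow> commutator G a y \<otimes> z = z \<otimes> commutator G a y"
    and b: "\<And>z. z \<in> carrier G \<Longrightarrow> commutator G b y \<otimes> z = z \<otimes> commutator G b y"
  shows "commutator G (commutator G a b) y = \<one>"
proof -
  define c d where "c = commutator G a y" and "d = commutator G b y"
  have [simp]: "c \<in> carrier G" "d \<in> carrier G" by (simp_all add: c_def d_def)
  have ay: "a \<otimes> y = c \<otimes> (y \<otimes> a)" and b_y: "b \<otimes> y = d \<otimes> (y \<otimes> b)"
    by (simp_all add: c_def d_def commutator_def m_assoc)
  have cz: "z \<otimes> c = c \<otimes> z" and dz: "z \<otimes> d = d \<otimes> z" if "z \<in> carrier G" for z
    using a b that by (simp_all add: c_def d_def)
  have "a \<otimes> b \<otimes> y = a \<otimes> d \<otimes> (y \<otimes> b)" by (simp add: m_assoc b_y)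
  also have "\<dots> = d \<otimes> (a \<otimes> y) \<otimes> b" by (simp add: dz m_assoc)
  also have "\<dots> = d \<otimes> c \<otimes> (y \<otimes> (a \<otimes> b))" by (simp add: ay m_assoc)
  finally have ab: "a \<otimes> b \<otimes> y = d \<otimes> c \<otimes> (y \<otimes> (a \<otimes> b))" .
  have "b \<otimes> a \<otimes> y = b \<otimes> c \<otimes> (y \<otimes> a)" by (simp add: m_assoc ay)
  also have "\<dots> = c \<otimes> (b \<otimes> y) \<otimes> a" by (simp add: cz m_assoc)
  also have "\<dots> = d \<otimes> c \<otimes> (y \<otimes> (b \<otimes> a))" by (simp add: b_y m_assoc cz[of d, symmetric]) (simp add: m_assoc[symmetric] cz)
  finally have ba: "b \<otimes> a \<otimes> y = d \<otimes> c \<otimes> (y \<otimes> (b \<otimes> a))" .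
  define u where "u = commutator G a b"
  have [simp]: "u \<in> carrier G" by (simp add: u_def)
  have u: "a \<otimes> b = u \<otimes> (b \<otimes> a)" by (simp add: u_def commutator_def m_assoc)
  \<comment> \<open>The two normal forms are compared through ab = u(ba); then ba cancels on the
    right and dc, being central, on the left.\<close>
  have "u \<otimes> (d \<otimes> c) \<otimes> (y \<otimes> (b \<otimes> a)) = (u \<otimes> (b \<otimes> a)) \<otimes> y" using ba by (simp add: m_assoc)
  also have "\<dots> = d \<otimes> c \<otimes> (y \<otimes> (u \<otimes> (b \<otimes> a)))" using ab u by simp
  finally have "u \<otimes> (d \<otimes> c) \<otimes> y \<otimes> (b \<otimes> a) = d \<otimes> c \<otimes> (y \<otimes> u) \<otimes> (b \<otimes> a)" by (simp add: m_assoc)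
  hence "u \<otimes> (d \<otimes> c) \<otimes> y = d \<otimes> c \<otimes> (y \<otimes> u)" by simp
  moreover have "u \<otimes> (d \<otimes> c) = d \<otimes> c \<otimes> u" by (simp add: m_assoc[symmetric] dz) (simp add: m_assoc cz)
  ultimately have "d \<otimes> c \<otimes> (u \<otimes> y) = d \<otimes> c \<otimes> (y \<otimes> u)" by (simp add: m_assoc)
  hence "u \<otimes> y = y \<otimes> u" by (metis \<open>c \<in> carrier G\<close> \<open>d \<in> carrier G\<close> \<open>u \<in> carrier G\<close> assms(3) l_cancel m_closed)
  thus ?thesis using commutator_eq_one_iff by (simp add: u_def)
qed

lemma equalizer_subgroup:
  assumes "group_hom G H p" "group_hom G H q"
  shows "subgroup {x \<in> carrier G. p x = q x} G"
proof -
  interpret p: group_hom G H p by fact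
  interpret q: group_hom G H q by fact
  show ?thesis by (rule subgroupI) auto
qed

lemma commute_inv:
  assumes "x \<in> carrier G" "y \<in> carrier G" "x \<otimes> y = y \<otimes> x"
  shows "inv x \<otimes> y = y \<otimes> inv x"
proof -
  have "inv x \<otimes> y = inv x \<otimes> (y \<otimes> x) \<otimes> inv x" using assms(1,2) by (simp add: m_assoc)
  also have "\<dots> = y \<otimes> inv x" using assms(1,2) by (simp add: assms(3) [symmetric] m_assoc)
  finally show ?thesis .
qed

text \<open>The setting for all calculations modulo \<gamma>_(k+2): since [G, \<gamma>_(k+1)] =
  \<gamma>_(k+2), the image of \<gamma>_(k+1) becomes central.\<close>

lemma lower_central_projection:
  obtains H :: "'a set monoid" and p where "group_hom G H p"
    "\<And>x. x \<in> carrier G \<Longrightarrow> p x = \<one>\<^bsub>H\<^esub> \<longleftrightarrow> x \<in> lower_central G (Suc (Suc k))"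
    "\<And>c z. c \<in> lower_central G (Suc k) \<Longrightarrow> z \<in> carrier H \<Longrightarrow> p c \<otimes>\<^bsub>H\<^esub> z = z \<otimes>\<^bsub>H\<^esub> p c"
proof -
  obtain H :: "'a set monoid" and p where hom: "group_hom G H p"
    and surj: "p ` carrier G = carrier H"
    and ker: "\<And>x. x \<in> carrier G \<Longrightarrow> p x = \<one>\<^bsub>H\<^esub> \<longleftrightarrow> x \<in> lower_central G (Suc (Suc k))"
    using normal_projection [OF lower_central_normal] by blast
  interpret p: group_hom G H p by fact
  have "p c \<otimes>\<^bsub>H\<^esub> z = z \<otimes>\<^bsub>H\<^esub> p c" if c: "c \<in> lower_central G (Suc k)" and "z \<in> carrier H" for c z
  proof -
    obtain f where f: "z = p f" "f \<in> carrier G" using \<open>z \<in> carrier H\<close> surj by blast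
    have c': "c \<in> carrier G" using c by (rule lower_central_closed)
    have "p (commutator G f c) = \<one>\<^bsub>H\<^esub>"
      using c c' f by (simp add: ker commutator_in_lower_central)
    thus ?thesis using c' f by (simp add: p.hom_commutator p.H.commutator_eq_one_iff)
  qed
  thus ?thesis using hom ker that by blast
qed

text \<open>The elements commuting with y modulo \<gamma>_(k+3) form a subgroup, so only the
  generators [a, b] of \<gamma>_2 matter. For these, [a, y] and [b, y] lie in \<gamma>_(k+2), which
  is central modulo \<gamma>_(k+3), and \<open>commute_commutator\<close> applies.\<close>

lemma commutator_derived_lower_central:
  assumes x: "x \<in> lower_central G (Suc (Suc 0))" and y: "y \<in> lower_central G (Suc k)"
  shows "commutator G x y \<in> lower_central G (Suc (Suc (Suc k)))"
proof -
  have [simp]: "y \<in> carrier G" using y by (rule lower_central_closed)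
  obtain H :: "'a set monoid" and p where "group_hom G H p"
    and ker: "\<And>x. x \<in> carrier G \<Longrightarrow> p x = \<one>\<^bsub>H\<^esub> \<longleftrightarrow> x \<in> lower_central G (Suc (Suc (Suc k)))"
    and central: "\<And>c z. c \<in> lower_central G (Suc (Suc k)) \<Longrightarrow> z \<in> carrier H \<Longrightarrow>
      p c \<otimes>\<^bsub>H\<^esub> z = z \<otimes>\<^bsub>H\<^esub> p c"
    using lower_central_projection [of "Suc k"] by blast
  interpret p: group_hom G H p by fact
  let ?K = "{x \<in> carrier G. p x \<otimes>\<^bsub>H\<^esub> p y = p y \<otimes>\<^bsub>H\<^esub> p x}"
  have "subgroup ?K G"
  proof (rule subgroupI)
    fix a b assume ab: "a \<in> ?K" "b \<in> ?K"
    hence "p a \<otimes>\<^bsub>H\<^esub> (p b \<otimes>\<^bsub>H\<^esub> p y) = p y \<otimes>\<^bsub>H\<^esub> p a \<otimes>\<^bsub>H\<^esub> p b"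
      using p.H.m_assoc [of "p a" "p y" "p b"] by simp
    thus "a \<otimes> b \<in> ?K" using ab by (simp add: p.H.m_assoc)
  next
    show "?K \<noteq> {}" using one_closed by force
  qed (auto simp: p.H.commute_inv)
  moreover have "{commutator G a b |a b. a \<in> carrier G \<and> b \<in> lower_central G (Suc 0)} \<subseteq> ?K"
  proof clarsimp
    fix a b assume [simp]: "a \<in> carrier G" "b \<in> carrier G"
    have "commutator H (p c) (p y) \<otimes>\<^bsub>H\<^esub> z = z \<otimes>\<^bsub>H\<^esub> commutator H (p c) (p y)"
      if "z \<in> carrier H" "c \<in> carrier G" for z c
      using central [of "commutator G c y" z] that y commutator_in_lower_central
      by (simp add: p.hom_commutator)
    hence "commutator H (commutator H (p a) (p b)) (p y) = \<one>\<^bsub>H\<^esub>"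
      by (intro p.H.commute_commutator) auto
    thus "p (commutator G a b) \<otimes>\<^bsub>H\<^esub> p y = p y \<otimes>\<^bsub>H\<^esub> p (commutator G a b)"
      by (simp add: p.hom_commutator p.H.commutator_eq_one_iff)
  qed
  ultimately have "lower_central G (Suc (Suc 0)) \<subseteq> ?K"
    unfolding lower_central_Suc_Suc by (rule generate_subgroup_incl [rotated])
  hence xK: "x \<in> carrier G" "p x \<otimes>\<^bsub>H\<^esub> p y = p y \<otimes>\<^bsub>H\<^esub> p x" using x by blast+
  hence "p (commutator G x y) = \<one>\<^bsub>H\<^esub>"
    by (simp add: p.hom_commutator p.H.commutator_eq_one_iff)
  thus ?thesis using xK ker by simp
qed

text \<open>An endomorphism inducing the identity on the abelianization induces the identity on every
  quotient of consecutive terms of the lower central series.\<close>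
lemma endo_lower_central:
  assumes phi: "group_hom G G \<phi>"
    and id: "\<And>x. x \<in> carrier G \<Longrightarrow> inv x \<otimes> \<phi> x \<in> lower_central G (Suc (Suc 0))"
    and y: "y \<in> lower_central G (Suc k)"
  shows "inv y \<otimes> \<phi> y \<in> lower_central G (Suc (Suc k))"
  using y
proof (induction k arbitrary: y)
  case 0
  then show ?case using id by simp
next
  case (Suc k)
  interpret phi: group_hom G G \<phi> by (rule phi)
  obtain H :: "'a set monoid" and p where "group_hom G H p"
    and ker: "\<And>x. x \<in> carrier G \<Longrightarrow> p x = \<one>\<^bsub>H\<^esub> \<longleftrightarrow> x \<in> lower_central G (Suc (Suc (Suc k)))"
    and central: "\<And>c z. c \<in> lower_central G (Suc (Suc k)) \<Longrightarrow> z \<in> carrier H \<Longrightarrow>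
      p c \<otimes>\<^bsub>H\<^esub> z = z \<otimes>\<^bsub>H\<^esub> p c"
    using lower_central_projection [of "Suc k"] by blast
  interpret p: group_hom G H p by fact
  \<comment> \<open>Agreement of \<phi> with the identity modulo \<gamma>_(k+3) defines a subgroup,
    so it suffices to treat the generators [a, b] of \<gamma>_(k+2).\<close>
  let ?E = "{x \<in> carrier G. p x = (p \<circ> \<phi>) x}"
  have "group_hom G H (p \<circ> \<phi>)"
    by (intro group_hom.intro group_hom_axioms.intro Group.hom_compose[of _ _ G])
      (auto simp: p.homh phi.homh)
  hence "subgroup ?E G"
    by (rule equalizer_subgroup [OF p.group_hom_axioms])
  moreover have "{commutator G a b |a b. a \<in> carrier G \<and> b \<in> lower_central G (Suc k)} \<subseteq> ?E"
  proof clarify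
    fix a b assume a [simp]: "a \<in> carrier G" and b: "b \<in> lower_central G (Suc k)"
    have [simp]: "b \<in> carrier G" using b by (rule lower_central_closed)
    define s t where "s = inv a \<otimes> \<phi> a" and "t = inv b \<otimes> \<phi> b"
    have [simp]: "s \<in> carrier G" "t \<in> carrier G" by (simp_all add: s_def t_def)
    have s: "s \<in> lower_central G (Suc (Suc 0))" and t: "t \<in> lower_central G (Suc (Suc k))"
      using id Suc.IH b by (simp_all add: s_def t_def)
    have eq: "\<phi> a = a \<otimes> s" "\<phi> b = b \<otimes> t" by (simp_all add: s_def t_def)
    have "p (commutator G s b) = \<one>\<^bsub>H\<^esub>"
      using commutator_derived_lower_central [OF s b] by (simp add: ker)
    hence sb: "p s \<otimes>\<^bsub>H\<^esub> p b = p b \<otimes>\<^bsub>H\<^esub> p s"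
      by (simp add: p.hom_commutator p.H.commutator_eq_one_iff)
    \<comment> \<open>Here \<phi>[a, b] = [as, bt]. The factor t drops out because its image is
      central; s drops out because it lies in \<gamma>_2 and so commutes with b modulo
      \<gamma>_(k+3), although its own image need not be central.\<close>
    have "p (\<phi> (commutator G a b)) = commutator H (p a \<otimes>\<^bsub>H\<^esub> p s) (p b \<otimes>\<^bsub>H\<^esub> p t)"
      by (simp add: phi.hom_commutator p.hom_commutator eq)
    also have "\<dots> = commutator H (p a \<otimes>\<^bsub>H\<^esub> p s) (p b)"
      by (subst p.H.commutator_eq_right_iff) (use central t in auto)
    also have "\<dots> = commutator H (p a) (p b)"
      by (subst p.H.commutator_eq_left_iff) (use sb in auto)
    finally show "commutator G a b \<in> carrier G \<and> p (commutator G a b) = (p \<circ> \<phi>) (commutator G a b)"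
      by (simp add: p.hom_commutator)
  qed
  ultimately have "lower_central G (Suc (Suc k)) \<subseteq> ?E"
    unfolding lower_central_Suc_Suc by (rule generate_subgroup_incl [rotated])
  hence y: "p y = p (\<phi> y)" "y \<in> carrier G" using Suc.prems by auto
  hence "p (inv y \<otimes> \<phi> y) = \<one>\<^bsub>H\<^esub>" using p.hom_eq_iff [of y "\<phi> y"] by simp
  thus ?case using y(2) by (subst ker [symmetric]) auto
qed

text \<open>Injectivity of \<phi> on the quotients by the lower central series: once x has reached
  \<gamma>_(k+1), it agrees with \<phi>(x) modulo \<gamma>_(k+2), so x descends one more term
  whenever \<phi>(x) does.\<close>

lemma endo_lower_central_inj:
  assumes phi: "group_hom G G \<phi>"
    and id: "\<And>x. x \<in> carrier G \<Longrightarrow> inv x \<otimes> \<phi> x \<in> lower_central G (Suc (Suc 0))"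
    and x: "x \<in> carrier G" "\<phi> x \<in> lower_central G (Suc k)"
  shows "x \<in> lower_central G (Suc k)"
  using x(2)
proof (induction k)
  case 0
  then show ?case using x by simp
next
  case (Suc k)
  interpret phi: group_hom G G \<phi> by (rule phi)
  interpret L: subgroup "lower_central G (Suc (Suc k))" G by (rule lower_central_subgroup)
  have *: "x \<in> lower_central G (Suc k)" using Suc lower_central_Suc_subset by blast
  have "inv x \<otimes> \<phi> x \<in> lower_central G (Suc (Suc k))" by (rule endo_lower_central [OF phi id *])
  hence "\<phi> x \<otimes> inv (inv x \<otimes> \<phi> x) \<in> lower_central G (Suc (Suc k))"
    by (rule L.m_closed [OF Suc.prems L.m_inv_closed])
  thus ?case using x by (simp add: inv_mult_group)
qed

text \<open>Successive approximation: the error c in x = \<phi>(y) c lies in \<gamma>_(k+1), where c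
  and \<phi>(c) agree modulo \<gamma>_(k+2). Replacing y by yc therefore moves the error into
  \<gamma>_(k+2). Nothing is claimed about surjectivity of \<phi> itself.\<close>

lemma endo_lower_central_surj:
  assumes phi: "group_hom G G \<phi>"
    and id: "\<And>x. x \<in> carrier G \<Longrightarrow> inv x \<otimes> \<phi> x \<in> lower_central G (Suc (Suc 0))"
    and x: "x \<in> carrier G"
  shows "\<exists>y \<in> carrier G. \<exists>c \<in> lower_central G (Suc k). x = \<phi> y \<otimes> c"
proof (induction k)
  case 0
  interpret phi: group_hom G G \<phi> by (rule phi)
  show ?case using x by (intro bexI[of _ \<one>] bexI[of _ x]) auto
next
  case (Suc k)
  interpret phi: group_hom G G \<phi> by (rule phi)
  interpret L: subgroup "lower_central G (Suc (Suc k))" G by (rule lower_central_subgroup)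
  obtain y c where yc: "y \<in> carrier G" "c \<in> lower_central G (Suc k)" "x = \<phi> y \<otimes> c"
    using Suc.IH by blast
  have c: "c \<in> carrier G" using yc(2) by (rule lower_central_closed)
  have "inv (inv c \<otimes> \<phi> c) \<in> lower_central G (Suc (Suc k))"
    by (intro L.m_inv_closed endo_lower_central [OF phi id yc(2)])
  moreover have "x = \<phi> (y \<otimes> c) \<otimes> inv (inv c \<otimes> \<phi> c)"
    using yc c by (simp add: inv_mult_group m_assoc)
  ultimately show ?case using m_closed [OF yc(1) c] by blast
qed

end

section \<open>Twisting a quotient by an endomorphism\<close>

lemma surj_same_kernel_imp_iso:
  assumes "group_hom G H h" "group_hom G K k"
    and "h ` carrier G = carrier H" "k ` carrier G = carrier K"
    and "\<And>x. x \<in> carrier G \<Longrightarrow> h x = \<one>\<^bsub>H\<^esub> \<longleftrightarrow> k x = \<one>\<^bsub>K\<^esub>"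
  shows "H \<cong> K"
proof -
  interpret h: group_hom G H h by fact
  interpret k: group_hom G K k by fact
  have eq: "kernel G H h = kernel G K k" using assms(5) by (auto simp: kernel_def)
  have "G Mod kernel G H h \<cong> H" "G Mod kernel G H h \<cong> K"
    using h.FactGroup_iso [OF assms(3)] k.FactGroup_iso [OF assms(4)] unfolding eq by auto
  moreover have "group (G Mod kernel G H h)"
    using h.normal_kernel by (rule normal.factorgroup_is_group)
  ultimately show ?thesis by (meson group.iso_sym iso_trans)
qed

lemma group_hom_compose:
  assumes "group_hom G H h" "group_hom H K k"
  shows "group_hom G K (\<lambda>x. k (h x))"
proof -
  interpret h: group_hom G H h by fact
  interpret k: group_hom H K k by fact
  show ?thesis by unfold_locales (auto simp: hom_def)
qed

locale abelian_trivial_endo = group_hom F F \<phi> + R: normal R F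
  for F (structure) and \<phi> and R +
  assumes endo_id: "\<And>x. x \<in> carrier F \<Longrightarrow> inv x \<otimes> \<phi> x \<in> lower_central F (Suc (Suc 0))"
begin

text \<open>This is M_(i+1) of the overview. With the shift, \<open>level 0\<close> is the whole of
  F and \<open>level 1\<close> the first term that carries information.\<close>

definition level :: "nat \<Rightarrow> 'a set" where
  "level i = lower_central F (Suc i) <#> \<phi> ` R"

definition limit :: "'a set" where
  "limit = (\<Inter>i. level i)"

lemma levelE:
  assumes "x \<in> level i"
  obtains c s where "c \<in> lower_central F (Suc i)" "s \<in> R" "x = c \<otimes> \<phi> s"
  using assms by (auto simp: level_def set_mult_def)

lemma levelI: "c \<in> lower_central F (Suc i) \<Longrightarrow> s \<in> R \<Longrightarrow> c \<otimes> \<phi> s \<in> level i"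
  by (auto simp: level_def set_mult_def)

lemma lower_central_subset_level: "lower_central F (Suc i) \<subseteq> level i"
  using levelI [OF _ R.one_closed] by (force dest: lower_central_closed)

lemma image_subset_limit: "s \<in> R \<Longrightarrow> \<phi> s \<in> limit"
  using levelI [OF subgroup.one_closed [OF lower_central_subgroup], of s] by (simp add: limit_def)

lemma level_subgroup: "subgroup (level i) F"
  unfolding level_def
  by (intro mult_norm_subgroup lower_central_normal subgroup_img_is_subgroup R.subgroup_axioms)

lemma endo_surj:
  assumes "x \<in> carrier F"
  obtains y c where "y \<in> carrier F" "c \<in> lower_central F (Suc k)" "x = \<phi> y \<otimes> c"
  using endo_lower_central_surj [OF group_hom_axioms endo_id assms] by blast

lemma endo_inj:
  assumes "x \<in> carrier F" "\<phi> x \<in> lower_central F (Suc k)"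
  shows "x \<in> lower_central F (Suc k)"
  by (rule endo_lower_central_inj [OF group_hom_axioms endo_id assms])

lemma endo_closed:
  assumes "c \<in> lower_central F (Suc k)"
  shows "\<phi> c \<in> lower_central F (Suc k)"
proof -
  interpret L: subgroup "lower_central F (Suc k)" F by (rule lower_central_subgroup)
  have "inv c \<otimes> \<phi> c \<in> lower_central F (Suc k)"
    using endo_lower_central [OF group_hom_axioms endo_id assms] lower_central_Suc_subset by blast
  hence "c \<otimes> (inv c \<otimes> \<phi> c) \<in> lower_central F (Suc k)" using assms by (rule L.m_closed [rotated])
  thus ?thesis using assms by (simp add: lower_central_closed)
qed

text \<open>The image \<phi>(R) need not be normal, as \<phi> need not be surjective. But every x is
  \<phi>(y) d with d in \<gamma>_(i+1)(F): conjugation by d is inner in \<open>level i\<close>, and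
  conjugation by \<phi>(y) sends \<phi>(s) to \<phi>(y s y^-1), where R is normal.\<close>

lemma level_normal: "level i \<lhd> F"
  unfolding normal_inv_iff
proof (intro conjI ballI level_subgroup)
  interpret L: normal "lower_central F (Suc i)" F by (rule lower_central_normal)
  interpret M: subgroup "level i" F by (rule level_subgroup)
  fix x m assume x: "x \<in> carrier F" and m: "m \<in> level i"
  obtain y d where yd: "y \<in> carrier F" "d \<in> lower_central F (Suc i)" "x = \<phi> y \<otimes> d"
    using endo_surj [OF x] by blast
  have dM: "d \<in> level i" using yd(2) lower_central_subset_level by blast
  have "d \<otimes> m \<otimes> inv d \<in> level i" using dM m by (intro M.m_closed M.m_inv_closed)
  then obtain c s where cs: "c \<in> lower_central F (Suc i)" "s \<in> R" "d \<otimes> m \<otimes> inv d = c \<otimes> \<phi> s"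
    by (rule levelE)
  have "x \<otimes> m \<otimes> inv x = \<phi> y \<otimes> (d \<otimes> m \<otimes> inv d) \<otimes> inv (\<phi> y)"
    using yd m dM by (simp add: inv_mult_group m_assoc)
  also have "\<dots> = (\<phi> y \<otimes> c \<otimes> inv (\<phi> y)) \<otimes> \<phi> (y \<otimes> s \<otimes> inv y)"
    unfolding cs(3) using yd cs by (simp add: m_assoc)
  also have "\<dots> \<in> level i"
    using yd cs by (intro levelI L.inv_op_closed2 R.inv_op_closed2) auto
  finally show "x \<otimes> m \<otimes> inv x \<in> level i" .
qed

lemma limit_normal: "limit \<lhd> F"
  unfolding normal_inv_iff
proof (intro conjI ballI)
  show "subgroup limit F"
    unfolding limit_def using level_subgroup by (intro subgroups_Inter) auto
  show "x \<otimes> h \<otimes> inv x \<in> limit" if "x \<in> carrier F" "h \<in> limit" for x h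
    using that level_normal by (auto simp: limit_def normal_inv_iff)
qed

section \<open>The quotient by \<open>limit\<close>, realized by any surjection \<open>p\<close>
  with this kernel\<close>

context
  fixes G :: "('g, 'h) monoid_scheme" and p
  assumes p_hom: "group_hom F G p" and p_surj: "p ` carrier F = carrier G"
    and p_ker: "\<And>x. x \<in> carrier F \<Longrightarrow> p x = \<one>\<^bsub>G\<^esub> \<longleftrightarrow> x \<in> limit"
begin

interpretation p: group_hom F G p by (rule p_hom)

text \<open>An element of \<gamma>_(i+1)(G) lifts to \<gamma>_(i+1)(F), and two lifts differ by an
  element of \<open>limit\<close>; \<open>level i\<close> contains both.\<close>

lemma image_in_lower_central_imp_level:
  assumes x: "x \<in> carrier F" and "p x \<in> lower_central G (Suc i)"
  shows "x \<in> level i"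
proof -
  interpret M: subgroup "level i" F by (rule level_subgroup)
  obtain c where c: "c \<in> lower_central F (Suc i)" "p x = p c"
    using assms(2) p.image_lower_central [OF p_surj, of "Suc i"] by (metis imageE)
  have c': "c \<in> carrier F" using c(1) by (rule lower_central_closed)
  have "p (inv c \<otimes> x) = \<one>\<^bsub>G\<^esub>" using p.hom_eq_iff [of c x] c c' x by simp
  hence "inv c \<otimes> x \<in> limit" using p_ker [of "inv c \<otimes> x"] c' x by (simp del: p.hom_mult)
  hence "inv c \<otimes> x \<in> level i" by (simp add: limit_def)
  with subsetD [OF lower_central_subset_level c(1)]
  have "c \<otimes> (inv c \<otimes> x) \<in> level i" by (rule M.m_closed)
  thus ?thesis using c' x by simp
qed

lemma residually_nilpotent_limit_quotient: "residually_nilpotent G"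
  unfolding residually_nilpotent_def
proof (intro equalityI subsetI)
  fix z assume "z \<in> (\<Inter>i\<in>{1..}. lower_central G i)"
  hence z: "z \<in> lower_central G (Suc i)" for i by auto
  obtain x where x: "x \<in> carrier F" "z = p x" using z [of 0] p_surj by auto
  have "x \<in> limit" unfolding limit_def
    using image_in_lower_central_imp_level x z by blast
  thus "z \<in> {\<one>\<^bsub>G\<^esub>}" using x p_ker by simp
qed (auto intro: subgroup.one_closed [OF p.H.lower_central_subgroup])

text \<open>Both quotients are images of F, the left one by way of \<phi>. Each of the two maps has
  kernel \<gamma>_(i+1)(F) R, so comparing kernels replaces the construction of a map between the
  quotients.\<close>

lemma lower_central_quotient_iso:
  assumes q_hom: "group_hom F H q" and q_surj: "q ` carrier F = carrier H"
    and q_ker: "\<And>x. x \<in> carrier F \<Longrightarrow> q x = \<one>\<^bsub>H\<^esub> \<longleftrightarrow> x \<in> R"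
  shows "G Mod lower_central G (Suc i) \<cong> H Mod lower_central H (Suc i)"
proof -
  interpret q: group_hom F H q by (rule q_hom)
  let ?LF = "lower_central F (Suc i)" and ?LG = "lower_central G (Suc i)"
    and ?LH = "lower_central H (Suc i)"
  interpret LF: normal ?LF F by (rule lower_central_normal)
  interpret LG: normal ?LG G by (rule p.H.lower_central_normal)
  interpret LH: normal ?LH H by (rule q.H.lower_central_normal)
  have imG: "p ` ?LF = ?LG" and imH: "q ` ?LF = ?LH"
    using p.image_lower_central [OF p_surj] q.image_lower_central [OF q_surj] by auto
  define u v where "u = (\<lambda>x. ?LG #>\<^bsub>G\<^esub> p x)" and "v = (\<lambda>x. ?LH #>\<^bsub>H\<^esub> q x)"
  interpret u: group_hom F "G Mod ?LG" u
    unfolding u_def by (rule group_hom_compose [OF p_hom LG.group_hom_rcoset])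
  interpret v: group_hom F "H Mod ?LH" v
    unfolding v_def by (rule group_hom_compose [OF q_hom LH.group_hom_rcoset])
  have u_surj: "u ` carrier F = carrier (G Mod ?LG)" and v_surj: "v ` carrier F = carrier (H Mod ?LH)"
    by (auto simp: u_def v_def carrier_FactGroup p_surj [symmetric] q_surj [symmetric])
  have u_one: "u x = \<one>\<^bsub>G Mod ?LG\<^esub> \<longleftrightarrow> p x \<in> ?LG" if "x \<in> carrier F" for x
    unfolding u_def using that by (intro LG.rcoset_eq_one_iff) simp
  have v_one: "v x = \<one>\<^bsub>H Mod ?LH\<^esub> \<longleftrightarrow> q x \<in> ?LH" if "x \<in> carrier F" for x
    unfolding v_def using that by (intro LH.rcoset_eq_one_iff) simp
  show ?thesis
  proof (rule surj_same_kernel_imp_iso)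
    show "group_hom F (G Mod ?LG) (\<lambda>x. u (\<phi> x))"
      by (rule group_hom_compose) (rule group_hom_axioms u.group_hom_axioms)+
    show "group_hom F (H Mod ?LH) v" by (rule v.group_hom_axioms)
    show "v ` carrier F = carrier (H Mod ?LH)" by (rule v_surj)
    show "(\<lambda>x. u (\<phi> x)) ` carrier F = carrier (G Mod ?LG)"
    proof
      show "carrier (G Mod ?LG) \<subseteq> (\<lambda>x. u (\<phi> x)) ` carrier F"
      proof
        fix z assume "z \<in> carrier (G Mod ?LG)"
        then obtain x where x: "x \<in> carrier F" "z = u x" using u_surj by blast
        \<comment> \<open>Surjectivity of \<phi> up to \<gamma>_(i+1)(F) is enough, because the
          error c dies in the target.\<close>
        obtain y c where yc: "y \<in> carrier F" "c \<in> ?LF" "x = \<phi> y \<otimes> c"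
          using endo_surj [OF x(1)] by blast
        have "c \<in> carrier F" using yc(2) by (rule lower_central_closed)
        moreover have "p c \<in> ?LG" using yc(2) imG by blast
        ultimately have "u c = \<one>\<^bsub>G Mod ?LG\<^esub>" by (subst u_one)
        hence "u x = u (\<phi> y) \<otimes>\<^bsub>G Mod ?LG\<^esub> \<one>\<^bsub>G Mod ?LG\<^esub>"
          unfolding yc(3) using yc \<open>c \<in> carrier F\<close> u.hom_mult [of "\<phi> y" c] by simp
        hence "z = u (\<phi> y)" using x yc u.H.r_one [of "u (\<phi> y)"] u.hom_closed [of "\<phi> y"] by simp
        thus "z \<in> (\<lambda>x. u (\<phi> x)) ` carrier F" using yc by blast
      qed
    qed (use u.hom_closed in auto)
    fix x assume x: "x \<in> carrier F"
    have "p (\<phi> x) \<in> ?LG \<longleftrightarrow> q x \<in> ?LH"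
    proof
      assume "p (\<phi> x) \<in> ?LG"
      hence "\<phi> x \<in> level i" using x by (intro image_in_lower_central_imp_level) auto
      then obtain c s where cs: "c \<in> ?LF" "s \<in> R" "\<phi> x = c \<otimes> \<phi> s" by (rule levelE)
      \<comment> \<open>Dividing by s moves the problem into \<gamma>_(i+1)(F), where injectivity of
        \<phi> modulo that term gives x in \<gamma>_(i+1)(F) R.\<close>
      have "\<phi> (x \<otimes> inv s) = c" using x cs by (simp add: lower_central_closed m_assoc)
      hence "\<phi> (x \<otimes> inv s) \<in> ?LF" using cs(1) by (simp only:)
      moreover have "x \<otimes> inv s \<in> carrier F" using x cs(2) by simp
      ultimately have "x \<otimes> inv s \<in> ?LF" by (rule endo_inj [rotated])
      hence "q (x \<otimes> inv s) \<in> ?LH" using imH by blast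
      moreover have "q s = \<one>\<^bsub>H\<^esub>" using cs(2) q_ker by simp
      ultimately show "q x \<in> ?LH" using x cs(2) by simp
    next
      assume "q x \<in> ?LH"
      then obtain c where c: "c \<in> ?LF" "q c = q x" using imH by (metis imageE)
      have c': "c \<in> carrier F" using c(1) by (rule lower_central_closed)
      have "q (inv c \<otimes> x) = \<one>\<^bsub>H\<^esub>" using q.hom_eq_iff [of c x] c c' x by simp
      hence R: "inv c \<otimes> x \<in> R" using q_ker [of "inv c \<otimes> x"] c' x by (simp del: q.hom_mult)
      hence "p (\<phi> (inv c \<otimes> x)) = \<one>\<^bsub>G\<^esub>"
        using image_subset_limit p_ker [of "\<phi> (inv c \<otimes> x)"] by (simp del: hom_mult)
      hence "p (\<phi> c) = p (\<phi> x)" using p.hom_eq_iff [of "\<phi> c" "\<phi> x"] c' x by simp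
      thus "p (\<phi> x) \<in> ?LG" using endo_closed [OF c(1)] imG by (metis imageI)
    qed
    thus "u (\<phi> x) = \<one>\<^bsub>G Mod ?LG\<^esub> \<longleftrightarrow> v x = \<one>\<^bsub>H Mod ?LH\<^esub>"
      using x u_one [of "\<phi> x"] v_one [of x] by simp
  qed
qed

end
end

section \<open>Presented groups\<close>

primrec eval_word :: "('a, 'b) monoid_scheme \<Rightarrow> (nat \<Rightarrow> 'a) \<Rightarrow> letter list \<Rightarrow> 'a" where
  "eval_word G h [] = \<one>\<^bsub>G\<^esub>"
| "eval_word G h (l # w) =
     (if snd l then inv\<^bsub>G\<^esub> (h (fst l)) else h (fst l)) \<otimes>\<^bsub>G\<^esub> eval_word G h w"

lemma eval_word_cong:
  "(\<And>l. l \<in> set w \<Longrightarrow> h (fst l) = h' (fst l)) \<Longrightarrow> eval_word G h w = eval_word G h' w"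
  by (induction w) auto

lemma (in group) eval_word_in_subgroup:
  assumes "subgroup K G" "\<And>i. i < n \<Longrightarrow> h i \<in> K" "w \<in> lists (letters n)"
  shows "eval_word G h w \<in> K"
  using assms(3)
proof (induction w)
  case Nil
  then show ?case using subgroup.one_closed [OF assms(1)] by simp
next
  case (Cons l w)
  hence "h (fst l) \<in> K" using assms(2) by (simp add: letters_def)
  thus ?case using Cons subgroup.m_closed [OF assms(1)] subgroup.m_inv_closed [OF assms(1)] by simp
qed

lemma (in group) eval_word_closed:
  "(\<And>i. i < n \<Longrightarrow> h i \<in> carrier G) \<Longrightarrow> w \<in> lists (letters n) \<Longrightarrow> eval_word G h w \<in> carrier G"
  by (rule eval_word_in_subgroup [OF subgroup_self])

lemma (in group) eval_word_append:
  assumes h: "\<And>i. i < n \<Longrightarrow> h i \<in> carrier G"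
    and "u \<in> lists (letters n)" "v \<in> lists (letters n)"
  shows "eval_word G h (u @ v) = eval_word G h u \<otimes> eval_word G h v"
  using assms(2)
proof (induction u)
  case Nil
  then show ?case using eval_word_closed [OF h assms(3)] by simp
next
  case (Cons l u)
  have "h (fst l) \<in> carrier G" using Cons h by (simp add: letters_def)
  thus ?case using Cons eval_word_closed [OF h assms(3)] eval_word_closed [of n h u] h
    by (simp add: m_assoc)
qed

lemma (in group_hom) hom_eval_word:
  assumes x: "\<And>i. i < n \<Longrightarrow> x i \<in> carrier G" and "w \<in> lists (letters n)"
  shows "h (eval_word G x w) = eval_word H (\<lambda>i. h (x i)) w"
  using assms(2)
proof (induction w)
  case (Cons l w)
  have "x (fst l) \<in> carrier G" using Cons x by (simp add: letters_def)
  thus ?case using Cons G.eval_word_closed [of n x w] x by simp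
qed simp

lemma inv_letter_in_letters [simp]: "inv_letter l \<in> letters n \<longleftrightarrow> l \<in> letters n"
  by (simp add: inv_letter_def letters_def)

lemma rev_map_inv_letter_in_lists [simp]:
  "rev (map inv_letter w) \<in> lists (letters n) \<longleftrightarrow> w \<in> lists (letters n)"
  by (induction w) auto

lemma pres_rel_in_lists:
  "(u, v) \<in> pres_rel n R \<Longrightarrow> u \<in> lists (letters n) \<and> v \<in> lists (letters n)"
  by (induction rule: pres_rel.induct) auto

lemma equiv_pres_rel: "equiv (lists (letters n)) (pres_rel n R)"
proof (rule equivI)
  show "pres_rel n R \<subseteq> lists (letters n) \<times> lists (letters n)"
    by (rule subrelI) (blast dest: pres_rel_in_lists)
  show "refl_on (lists (letters n)) (pres_rel n R)"
    by (rule refl_onI) (auto intro: pres_rel.refl)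
  show "sym (pres_rel n R)" by (rule symI) (rule pres_rel.sym)
  show "trans (pres_rel n R)" by (rule transI) (rule pres_rel.trans)
qed

text \<open>Both elementary moves already carry an arbitrary context, so enlarging it yields the
  same kind of move.\<close>

lemma pres_rel_context:
  assumes "(u, v) \<in> pres_rel n R" "a \<in> lists (letters n)" "b \<in> lists (letters n)"
  shows "(a @ u @ b, a @ v @ b) \<in> pres_rel n R"
  using assms(1)
proof (induction rule: pres_rel.induct)
  case (refl w)
  then show ?case using assms by (intro pres_rel.refl) auto
next
  case (cancel u v x)
  then show ?case using assms pres_rel.cancel [of "a @ u" n "v @ b" x R] by simp
next
  case (relator u v r)
  then show ?case using assms pres_rel.relator [of "a @ u" n "v @ b" r R] by simp
qed (blast intro: pres_rel.sym pres_rel.trans)+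

lemma pres_rel_append:
  assumes "(u, u') \<in> pres_rel n R" "(v, v') \<in> pres_rel n R"
  shows "(u @ v, u' @ v') \<in> pres_rel n R"
proof (rule pres_rel.trans)
  show "(u @ v, u' @ v) \<in> pres_rel n R"
    using pres_rel_context [OF assms(1), of "[]" v] pres_rel_in_lists [OF assms(2)] by simp
  show "(u' @ v, u' @ v') \<in> pres_rel n R"
    using pres_rel_context [OF assms(2), of u' "[]"] pres_rel_in_lists [OF assms(1)] by simp
qed

definition word_class :: "nat \<Rightarrow> letter list set \<Rightarrow> letter list \<Rightarrow> letter list set" where
  "word_class n R w = pres_rel n R `` {w}"

definition pres_gen :: "nat \<Rightarrow> letter list set \<Rightarrow> nat \<Rightarrow> letter list set" where
  "pres_gen n R i = word_class n R [(i, False)]"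

lemma carrier_presented_group: "carrier (presented_group n R) = word_class n R ` lists (letters n)"
  by (auto simp: presented_group_def quotient_def word_class_def)

lemma one_presented_group: "\<one>\<^bsub>presented_group n R\<^esub> = word_class n R []"
  by (simp add: presented_group_def word_class_def)

lemma word_class_eq_iff:
  assumes "u \<in> lists (letters n)" "v \<in> lists (letters n)"
  shows "word_class n R u = word_class n R v \<longleftrightarrow> (u, v) \<in> pres_rel n R"
  unfolding word_class_def using eq_equiv_class_iff [OF equiv_pres_rel assms] .

lemma mult_presented_group:
  assumes "u \<in> lists (letters n)" "v \<in> lists (letters n)"
  shows "word_class n R u \<otimes>\<^bsub>presented_group n R\<^esub> word_class n R v = word_class n R (u @ v)"
proof -
  have "word_class n R (a @ b) = word_class n R (u @ v)"
    if "a \<in> word_class n R u" "b \<in> word_class n R v" for a b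
  proof -
    have *: "(u, a) \<in> pres_rel n R" "(v, b) \<in> pres_rel n R" using that by (auto simp: word_class_def)
    hence "(u @ v, a @ b) \<in> pres_rel n R" by (rule pres_rel_append)
    thus ?thesis using pres_rel_in_lists * by (subst word_class_eq_iff) (auto intro: pres_rel.sym)
  qed
  moreover have "u \<in> word_class n R u" "v \<in> word_class n R v"
    using assms by (auto simp: word_class_def intro: pres_rel.refl)
  ultimately have "(\<Union>a\<in>word_class n R u. \<Union>b\<in>word_class n R v. word_class n R (a @ b)) = word_class n R (u @ v)"
    by blast
  thus ?thesis by (simp add: presented_group_def word_class_def)
qed

lemma word_class_inverse:
  assumes "w \<in> lists (letters n)"
  shows "word_class n R (rev (map inv_letter w) @ w) = word_class n R []"
  using assms
proof (induction w)
  case (Cons l w)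
  have w: "w \<in> lists (letters n)" "rev (map inv_letter w) \<in> lists (letters n)" "l \<in> letters n"
    using Cons.hyps by simp_all
  \<comment> \<open>The rule \<open>cancel\<close> removes a letter followed by its inverse; it is
    used for the letter \<open>inv_letter l\<close>, whose inverse is l again.\<close>
  have "(rev (map inv_letter w) @ [inv_letter l, inv_letter (inv_letter l)] @ w, rev (map inv_letter w) @ w) \<in> pres_rel n R"
    by (intro pres_rel.cancel) (simp_all add: w)
  moreover have "inv_letter (inv_letter l) = l" by (simp add: inv_letter_def)
  ultimately have "word_class n R (rev (map inv_letter (l # w)) @ (l # w)) = word_class n R (rev (map inv_letter w) @ w)"
    by (subst word_class_eq_iff) (simp_all add: w)
  thus ?case using Cons.IH w by simp
qed simp

lemma group_presented_group: "group (presented_group n R)"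
proof (rule groupI)
  let ?P = "presented_group n R"
  show "\<one>\<^bsub>?P\<^esub> \<in> carrier ?P"
    by (auto simp: carrier_presented_group one_presented_group)
  fix x assume "x \<in> carrier ?P"
  then obtain u where u: "u \<in> lists (letters n)" "x = word_class n R u"
    by (auto simp: carrier_presented_group)
  show "\<one>\<^bsub>?P\<^esub> \<otimes>\<^bsub>?P\<^esub> x = x"
    using u by (simp add: one_presented_group mult_presented_group)
  have "word_class n R (rev (map inv_letter u)) \<otimes>\<^bsub>?P\<^esub> x = \<one>\<^bsub>?P\<^esub>"
    unfolding u(2) one_presented_group
    by (subst mult_presented_group) (simp_all add: word_class_inverse u(1))
  moreover have "word_class n R (rev (map inv_letter u)) \<in> carrier ?P"
    unfolding carrier_presented_group by (intro imageI) (simp add: u(1))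
  ultimately show "\<exists>y\<in>carrier ?P. y \<otimes>\<^bsub>?P\<^esub> x = \<one>\<^bsub>?P\<^esub>" by blast
  fix y assume "y \<in> carrier ?P"
  then obtain v where v: "v \<in> lists (letters n)" "y = word_class n R v"
    by (auto simp: carrier_presented_group)
  have uv: "u @ v \<in> lists (letters n)" using u v by auto
  show "x \<otimes>\<^bsub>?P\<^esub> y \<in> carrier ?P"
    using u v uv by (simp only: mult_presented_group carrier_presented_group imageI)
  fix z assume "z \<in> carrier ?P"
  then obtain w where w: "w \<in> lists (letters n)" "z = word_class n R w"
    by (auto simp: carrier_presented_group)
  have vw: "v @ w \<in> lists (letters n)" using w v by auto
  show "x \<otimes>\<^bsub>?P\<^esub> y \<otimes>\<^bsub>?P\<^esub> z = x \<otimes>\<^bsub>?P\<^esub> (y \<otimes>\<^bsub>?P\<^esub> z)"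
    by (simp only: u(2) v(2) w(2) mult_presented_group u(1) v(1) w(1) uv vw append_assoc)
qed

lemma pres_gen_closed: "i < n \<Longrightarrow> pres_gen n R i \<in> carrier (presented_group n R)"
  by (auto simp: pres_gen_def carrier_presented_group letters_def)

lemma inv_pres_gen:
  assumes "i < n"
  shows "inv\<^bsub>presented_group n R\<^esub> pres_gen n R i = word_class n R [(i, True)]"
proof -
  interpret group "presented_group n R" by (rule group_presented_group)
  have l: "[(i, True)] \<in> lists (letters n)" "[(i, False)] \<in> lists (letters n)"
    using assms by (auto simp: letters_def)
  have "word_class n R [(i, True)] \<otimes>\<^bsub>presented_group n R\<^esub> pres_gen n R i = \<one>\<^bsub>presented_group n R\<^esub>"
    using word_class_inverse [OF l(2), of R] mult_presented_group [OF l]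
    by (simp add: pres_gen_def one_presented_group inv_letter_def)
  thus ?thesis
    using l assms by (intro inv_equality pres_gen_closed) (auto simp: carrier_presented_group)
qed

lemma eval_word_pres_gen:
  assumes "w \<in> lists (letters n)"
  shows "eval_word (presented_group n R) (pres_gen n R) w = word_class n R w"
  using assms
proof (induction w)
  case (Cons l w)
  have l: "[l] \<in> lists (letters n)" "fst l < n" using Cons by (auto simp: letters_def)
  have "(if snd l then inv\<^bsub>presented_group n R\<^esub> pres_gen n R (fst l) else pres_gen n R (fst l)) = word_class n R [l]"
    using l(2) inv_pres_gen [of "fst l" n R] by (cases l) (simp add: pres_gen_def)
  thus ?case using Cons l mult_presented_group [OF l(1), of w R] by simp
qed (simp add: one_presented_group)

lemma subgroup_presented_group_eq_carrier:
  assumes "subgroup K (presented_group n R)" "\<And>i. i < n \<Longrightarrow> pres_gen n R i \<in> K"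
  shows "K = carrier (presented_group n R)"
proof
  show "K \<subseteq> carrier (presented_group n R)" by (rule subgroup.subset [OF assms(1)])
  show "carrier (presented_group n R) \<subseteq> K"
  proof
    fix x assume "x \<in> carrier (presented_group n R)"
    then obtain w where w: "w \<in> lists (letters n)" "x = word_class n R w"
      unfolding carrier_presented_group by blast
    have "eval_word (presented_group n R) (pres_gen n R) w \<in> K"
      by (rule group.eval_word_in_subgroup [OF group_presented_group assms(1) _ w(1)]) (rule assms(2))
    thus "x \<in> K" using w by (simp add: eval_word_pres_gen)
  qed
qed

lemma word_class_relator:
  "r \<in> R \<Longrightarrow> r \<in> lists (letters n) \<Longrightarrow> word_class n R r = \<one>\<^bsub>presented_group n R\<^esub>"
  using pres_rel.relator [of "[]" n "[]" r R] word_class_eq_iff [of r n "[]" R]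
  by (simp add: one_presented_group)

lemma eval_word_pres_rel:
  assumes "group H" and h: "\<And>i. i < n \<Longrightarrow> h i \<in> carrier H"
    and rel: "\<And>r. r \<in> R \<Longrightarrow> r \<in> lists (letters n) \<Longrightarrow> eval_word H h r = \<one>\<^bsub>H\<^esub>"
    and "(u, v) \<in> pres_rel n R"
  shows "eval_word H h u = eval_word H h v"
proof -
  interpret group H by fact
  note eval_simps = eval_word_append [where n = n, OF h] eval_word_closed [where n = n, OF h]
  show ?thesis using assms(4)
  proof (induction rule: pres_rel.induct)
    case (cancel u v x)
    have x: "h (fst x) \<in> carrier H" using cancel h by (simp add: letters_def)
    have "eval_word H h (u @ [x, inv_letter x] @ v) = eval_word H h u \<otimes>\<^bsub>H\<^esub> eval_word H h ([x, inv_letter x] @ v)"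
      using cancel by (intro eval_simps(1)) auto
    also have "eval_word H h ([x, inv_letter x] @ v) = eval_word H h v"
      using x cancel by (simp add: inv_letter_def eval_simps)
    also have "eval_word H h u \<otimes>\<^bsub>H\<^esub> eval_word H h v = eval_word H h (u @ v)"
      using cancel by (simp add: eval_simps)
    finally show ?case .
  next
    case (relator u v r)
    have "eval_word H h (u @ r @ v) = eval_word H h u \<otimes>\<^bsub>H\<^esub> (eval_word H h r \<otimes>\<^bsub>H\<^esub> eval_word H h v)"
      using relator by (subst eval_simps(1)) (auto simp: eval_simps(1))
    thus ?case using relator rel by (simp add: eval_simps)
  qed auto
qed

text \<open>Von Dyck's theorem: a class is evaluated on a chosen representative, and the elementary
  moves do not change the value. With \<open>R = {}\<close> it is the universal property of the free
  group.\<close>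

lemma presented_group_lift:
  assumes "group H" and h: "\<And>i. i < n \<Longrightarrow> h i \<in> carrier H"
    and rel: "\<And>r. r \<in> R \<Longrightarrow> r \<in> lists (letters n) \<Longrightarrow> eval_word H h r = \<one>\<^bsub>H\<^esub>"
  obtains f where "group_hom (presented_group n R) H f"
    "\<And>w. w \<in> lists (letters n) \<Longrightarrow> f (word_class n R w) = eval_word H h w"
    "\<And>i. i < n \<Longrightarrow> f (pres_gen n R i) = h i"
proof -
  interpret group H by fact
  define f where "f c = eval_word H h (inv_into (lists (letters n)) (word_class n R) c)" for c
  have f: "f (word_class n R w) = eval_word H h w" if w: "w \<in> lists (letters n)" for w
  proof -
    let ?v = "inv_into (lists (letters n)) (word_class n R) (word_class n R w)"
    have "?v \<in> lists (letters n)" "word_class n R ?v = word_class n R w"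
      by (simp_all add: inv_into_into f_inv_into_f w)
    hence rel_v: "(?v, w) \<in> pres_rel n R" using w by (simp add: word_class_eq_iff)
    show ?thesis unfolding f_def by (rule eval_word_pres_rel [OF assms(1) h rel rel_v])
  qed
  have gen: "f (pres_gen n R i) = h i" if "i < n" for i
    using that h f [of "[(i, False)]"] by (simp add: pres_gen_def letters_def)
  have "f \<in> hom (presented_group n R) H"
  proof (rule homI)
    fix x assume "x \<in> carrier (presented_group n R)"
    then obtain u where u: "u \<in> lists (letters n)" "x = word_class n R u"
      by (auto simp: carrier_presented_group)
    thus "f x \<in> carrier H" using eval_word_closed [of n h u] h by (simp add: f)
    fix y assume "y \<in> carrier (presented_group n R)"
    then obtain v where v: "v \<in> lists (letters n)" "y = word_class n R v"
      by (auto simp: carrier_presented_group)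
    have "f (word_class n R (u @ v)) = eval_word H h (u @ v)" using u v by (intro f) auto
    thus "f (x \<otimes>\<^bsub>presented_group n R\<^esub> y) = f x \<otimes>\<^bsub>H\<^esub> f y"
      using u v eval_word_append [of n h u v] h by (simp add: f mult_presented_group)
  qed
  hence "group_hom (presented_group n R) H f"
    by (intro group_hom.intro group_hom_axioms.intro group_presented_group assms(1))
  thus ?thesis using f gen that by blast
qed

section \<open>Symmetric groups\<close>

text \<open>The complements of A and f(A) have equally many points, so any bijection between them
  completes f. Conjugating permutations can thus be prescribed on a few points only.\<close>

lemma permutes_extend_inj:
  assumes "finite S" "A \<subseteq> S" "f ` A \<subseteq> S" "inj_on f A"
  obtains h where "h permutes S" "\<And>x. x \<in> A \<Longrightarrow> h x = f x"
proof -
  have "card (S - A) = card (S - f ` A)"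
    using assms by (simp add: card_Diff_subset finite_subset card_image)
  then obtain g where g: "bij_betw g (S - A) (S - f ` A)"
    using assms(1) by (metis finite_Diff finite_same_card_bij)
  let ?h = "\<lambda>x. if x \<in> A then f x else if x \<in> S then g x else x"
  have "bij_betw ?h A (f ` A)"
    using assms(4) by (subst bij_betw_cong [of A _ f]) (auto simp: bij_betw_def)
  moreover have "bij_betw ?h (S - A) (S - f ` A)"
    using g by (subst bij_betw_cong [of "S - A" _ g]) auto
  ultimately have "bij_betw ?h (A \<union> (S - A)) (f ` A \<union> (S - f ` A))"
    by (rule bij_betw_combine) auto
  moreover have "A \<union> (S - A) = S" "f ` A \<union> (S - f ` A) = S" using assms by auto
  ultimately have "?h permutes S" using assms(2) by (intro bij_imp_permutes) auto
  thus ?thesis using that by auto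
qed

lemma ex_not_mem:
  assumes "finite A" "card A < card B"
  obtains x where "x \<in> B" "x \<notin> A"
  using assms by (meson card_mono linorder_not_less subsetI)

text \<open>The conjugate of \<open>y\<close> is chosen so that it fails to commute with \<open>x\<close> at a point \<open>p\<close> moved
  by \<open>x\<close>; a fixed-point-free \<open>y\<close> needs four points.\<close>
lemma permutes_noncommuting_conjugate:
  assumes S: "finite S" "5 \<le> card S" and x: "x permutes S" "x \<noteq> id" and y: "y permutes S" "y \<noteq> id"
  obtains h where "h permutes S" "x \<circ> (h \<circ> y \<circ> inv' h) \<noteq> (h \<circ> y \<circ> inv' h) \<circ> x"
proof -
  obtain p where p: "x p \<noteq> p" using x by (auto simp: fun_eq_iff)
  hence pS: "p \<in> S" "x p \<in> S" using x by (auto simp: permutes_def permutes_in_image [OF x(1)])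
  have inj_x: "x a = x b \<longleftrightarrow> a = b" for a b using permutes_inj [OF x(1)] by (auto simp: inj_eq)
  have inj_y: "y a = y b \<longleftrightarrow> a = b" for a b using permutes_inj [OF y(1)] by (auto simp: inj_eq)
  have yS: "y a \<in> S \<longleftrightarrow> a \<in> S" for a by (rule permutes_in_image [OF y(1)])
  show ?thesis
  proof (cases "\<exists>c\<in>S. y c = c")
    case True
    then obtain c where c: "c \<in> S" "y c = c" by blast
    obtain m where m: "y m \<noteq> m" using y by (auto simp: fun_eq_iff)
    hence mS: "m \<in> S" using y by (auto simp: permutes_def)
    have cm: "c \<noteq> m" using c m by auto
    \<comment> \<open>The conjugate z of y then fixes p but moves x p, so x (z p) = x p differs from
      z (x p).\<close>
    obtain h where h: "h permutes S" "\<And>a. a \<in> {c, m} \<Longrightarrow> h a = (id(c := p, m := x p)) a"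
      by (rule permutes_extend_inj [of S "{c, m}" "id(c := p, m := x p)"])
        (use S c mS pS p cm in \<open>auto simp: inj_on_def\<close>)
    have hc: "h c = p" "h m = x p" using h(2) cm by auto
    have inv: "inv' h (h a) = a" for a using permutes_inverses(2) [OF h(1)] .
    have "inv' h p = c" "inv' h (x p) = m" using inv hc by metis+
    moreover have "h (y m) \<noteq> h m" using m permutes_inj [OF h(1)] by (auto simp: inj_eq)
    ultimately have "(x \<circ> (h \<circ> y \<circ> inv' h)) p \<noteq> ((h \<circ> y \<circ> inv' h) \<circ> x) p"
      using c hc by auto
    thus ?thesis using that [OF h(1)] by metis
  next
    case False
    obtain a where a: "a \<in> S" using pS by blast
    \<comment> \<open>Excluding \<open>inv' y a\<close> ensures y b \<noteq> a, so that a, b, y a, y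
      b are four distinct points.\<close>
    obtain b where b: "b \<in> S" "b \<notin> {a, y a, inv' y a}"
      by (rule ex_not_mem [of "{a, y a, inv' y a}" S]) (use S in \<open>auto simp: card_insert_if\<close>)
    have yinv: "y (inv' y a) = a" using permutes_inverses(1) [OF y(1)] .
    have yb: "y b \<noteq> a" using b yinv inj_y by (metis insertCI)
    have dist: "a \<noteq> b" "y a \<noteq> a" "y a \<noteq> b" "y b \<noteq> b" "y a \<noteq> y b" "y b \<noteq> a"
      using False a b yb inj_y by auto
    obtain q where q: "q \<in> S" "q \<notin> {p, x p}"
      by (rule ex_not_mem [of "{p, x p}" S]) (use S in \<open>auto simp: card_insert_if\<close>)
    \<comment> \<open>The conjugate z of y will send p to q and x p to s. Avoiding x q gives x (z p)
      \<noteq> z (x p), and avoiding p, x p, q keeps the prescription injective; this is where five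
      points are used.\<close>
    obtain s where s: "s \<in> S" "s \<notin> {p, x p, q, x q}"
      by (rule ex_not_mem [of "{p, x p, q, x q}" S]) (use S in \<open>auto simp: card_insert_if\<close>)
    let ?f = "id(a := p, b := x p, y a := q, y b := s)"
    obtain h where h: "h permutes S" "\<And>c. c \<in> {a, b, y a, y b} \<Longrightarrow> h c = ?f c"
      by (rule permutes_extend_inj [of S "{a, b, y a, y b}" ?f])
        (use S a b q s pS p dist yS in \<open>auto simp: inj_on_def\<close>)
    have hc: "h a = p" "h b = x p" "h (y a) = q" "h (y b) = s" using h(2) dist by auto
    have inv: "inv' h (h a) = a" for a using permutes_inverses(2) [OF h(1)] .
    have "inv' h p = a" "inv' h (x p) = b" using inv hc by metis+
    hence "(x \<circ> (h \<circ> y \<circ> inv' h)) p \<noteq> ((h \<circ> y \<circ> inv' h) \<circ> x) p"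
      using hc s by auto
    thus ?thesis using that [OF h(1)] by metis
  qed
qed

lemma sym_group_generated_by_adjacent:
  assumes "subgroup K (sym_group n)"
    and gens: "\<And>i. 1 \<le> i \<Longrightarrow> i < n \<Longrightarrow> Transposition.transpose i (Suc i) \<in> K"
  shows "K = carrier (sym_group n)"
proof
  interpret K: subgroup K "sym_group n" by fact
  have comp: "p \<circ> q \<in> K" if "p \<in> K" "q \<in> K" for p q
    using K.m_closed [OF that] by (simp add: sym_group_mult)
  have id: "id \<in> K" using K.one_closed by (simp add: sym_group_one)
  have adj: "apply_adj_transps xs \<in> K" if "set xs \<subseteq> {1..<n}" for xs
    using that by (induction xs) (auto intro!: comp gens id)
  have less: "Transposition.transpose a b \<in> K" if "1 \<le> a" "a < b" "b \<le> n" for a b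
    using adj [of "adj_transp_seq a b"] adj_transp_seq_correct [of a b] set_adj_transp_seq [of a b] that
    by auto
  have transp: "Transposition.transpose a b \<in> K" if "a \<in> {1..n}" "b \<in> {1..n}" "a \<noteq> b" for a b
    using that less [of a b] less [of b a] by (cases "a < b") (auto simp: transpose_commute)
  show "carrier (sym_group n) \<subseteq> K"
  proof
    fix p assume "p \<in> carrier (sym_group n)"
    hence "p permutes {1..n}" by (simp add: sym_group_carrier)
    thus "p \<in> K" using finite_atLeastAtMost
    proof (induction rule: permutes_induct)
      case (swap a b p)
      thus ?case using comp transp by blast
    qed (rule id)
  qed
  show "K \<subseteq> carrier (sym_group n)" by (rule K.subset)
qed

section \<open>Avoiding words\<close>

lemma group_hom_factor:
  assumes "group_hom F G p" "p ` carrier F = carrier G" "group_hom F H v"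
    and ker: "\<And>x. x \<in> carrier F \<Longrightarrow> p x = \<one>\<^bsub>G\<^esub> \<Longrightarrow> v x = \<one>\<^bsub>H\<^esub>"
  obtains w where "group_hom G H w" "\<And>x. x \<in> carrier F \<Longrightarrow> w (p x) = v x"
proof -
  interpret p: group_hom F G p by fact
  interpret v: group_hom F H v by fact
  define w where "w z = v (inv_into (carrier F) p z)" for z
  have w: "w (p x) = v x" if x: "x \<in> carrier F" for x
  proof -
    let ?y = "inv_into (carrier F) p (p x)"
    have y: "?y \<in> carrier F" "p ?y = p x" by (simp_all add: inv_into_into f_inv_into_f x)
    hence "p (inv\<^bsub>F\<^esub> ?y \<otimes>\<^bsub>F\<^esub> x) = \<one>\<^bsub>G\<^esub>" using p.hom_eq_iff [of ?y x] x by simp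
    hence "v (inv\<^bsub>F\<^esub> ?y \<otimes>\<^bsub>F\<^esub> x) = \<one>\<^bsub>H\<^esub>" using ker y x by simp
    thus ?thesis using v.hom_eq_iff [of ?y x] x y by (simp add: w_def)
  qed
  have "w \<in> hom G H"
  proof (rule homI)
    fix a assume "a \<in> carrier G"
    then obtain x where x: "x \<in> carrier F" "a = p x" using assms(2) by blast
    thus "w a \<in> carrier H" using w by simp
    fix b assume "b \<in> carrier G"
    then obtain y where y: "y \<in> carrier F" "b = p y" using assms(2) by blast
    have "w (p (x \<otimes>\<^bsub>F\<^esub> y)) = v (x \<otimes>\<^bsub>F\<^esub> y)" using x y by (intro w) simp
    thus "w (a \<otimes>\<^bsub>G\<^esub> b) = w a \<otimes>\<^bsub>H\<^esub> w b" using x y w by simp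
  qed
  hence "group_hom G H w" by (intro group_hom.intro group_hom_axioms.intro) auto
  thus ?thesis using w that by blast
qed

text \<open>The required group has carrier type \<open>nat\<close>, so the cosets are numbered and
  the multiplication is transported along the numbering.\<close>

lemma (in group) countable_quotient_nat:
  assumes "countable (carrier G)" "N \<lhd> G"
  obtains H :: "nat monoid" and p where "group_hom G H p" "p ` carrier G = carrier H"
    "\<And>x. x \<in> carrier G \<Longrightarrow> p x = \<one>\<^bsub>H\<^esub> \<longleftrightarrow> x \<in> N"
proof -
  interpret N: normal N G by fact
  define f where "f x = to_nat_on (carrier (G Mod N)) (N #> x)" for x
  have cnt: "countable (carrier (G Mod N))"
    using assms(1) by (simp add: carrier_FactGroup)
  interpret q: group_hom G "G Mod N" "\<lambda>x. N #> x" by (rule N.group_hom_rcoset)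
  have "f a = f b \<longleftrightarrow> a \<otimes> inv b \<in> N" if "a \<in> carrier G" "b \<in> carrier G" for a b
  proof -
    have "f a = f b \<longleftrightarrow> N #> a = N #> b"
      using inj_on_to_nat_on [OF cnt] that by (auto simp: f_def inj_on_def carrier_FactGroup)
    also have "\<dots> \<longleftrightarrow> a \<in> N #> b"
      using that N.subgroup_axioms by (metis repr_independence rcos_self)
    also have "\<dots> \<longleftrightarrow> a \<otimes> inv b \<in> N"
      using that by (intro N.rcos_module) auto
    finally show ?thesis .
  qed
  with assms(2) have wgm: "weak_group_morphism f N G" by (rule weak_group_morphismsI)
  show ?thesis
  proof
    show "group_hom G (image_group f G) f" by (rule weak_group_morphism_group_hom [OF wgm])
    show "f ` carrier G = carrier (image_group f G)" by (simp add: image_group_carrier)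
    show "f x = \<one>\<^bsub>image_group f G\<^esub> \<longleftrightarrow> x \<in> N" if "x \<in> carrier G" for x
      using weak_group_morphism_ker [OF wgm] that by (auto simp: kernel_def)
  qed
qed

section \<open>The group (Z/2)^n, which bounds ranks from below\<close>

definition parity_group :: "nat \<Rightarrow> nat set monoid" where
  "parity_group n = \<lparr>carrier = Pow {..<n}, monoid.mult = (\<lambda>A B. (A - B) \<union> (B - A)), one = {}\<rparr>"

lemma parity_group_simps [simp]:
  "carrier (parity_group n) = Pow {..<n}"
  "A \<otimes>\<^bsub>parity_group n\<^esub> B = (A - B) \<union> (B - A)"
  "\<one>\<^bsub>parity_group n\<^esub> = {}"
  by (simp_all add: parity_group_def)

lemma group_parity_group: "group (parity_group n)"
  by (rule groupI) auto

lemma inv_parity_group: "A \<subseteq> {..<n} \<Longrightarrow> inv\<^bsub>parity_group n\<^esub> A = A"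
  by (rule group.inv_equality [OF group_parity_group]) auto

text \<open>Every element is its own inverse, so two summands a cancel and adjoining a adds at most
  the one coset a + K.\<close>

lemma subgroup_parity_group_insert:
  assumes "subgroup K (parity_group n)" "a \<subseteq> {..<n}"
  shows "subgroup (K \<union> (\<lambda>z. (a - z) \<union> (z - a)) ` K) (parity_group n)"
proof -
  interpret group "parity_group n" by (rule group_parity_group)
  interpret K: subgroup K "parity_group n" by fact
  have K: "(z - w) \<union> (w - z) \<in> K" if "z \<in> K" "w \<in> K" for z w
    using K.m_closed [OF that] by simp
  have sub: "z \<subseteq> {..<n}" if "z \<in> K" for z using K.subset that by auto
  show ?thesis
  proof (rule subgroupI)
    show "K \<union> (\<lambda>z. (a - z) \<union> (z - a)) ` K \<subseteq> carrier (parity_group n)"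
      using sub assms(2) by auto
    show "K \<union> (\<lambda>z. (a - z) \<union> (z - a)) ` K \<noteq> {}" using K.one_closed by auto
    fix x assume x: "x \<in> K \<union> (\<lambda>z. (a - z) \<union> (z - a)) ` K"
    hence "x \<subseteq> {..<n}" using sub assms(2) by auto
    thus "inv\<^bsub>parity_group n\<^esub> x \<in> K \<union> (\<lambda>z. (a - z) \<union> (z - a)) ` K"
      using x by (simp only: inv_parity_group)
    fix y assume y: "y \<in> K \<union> (\<lambda>z. (a - z) \<union> (z - a)) ` K"
    obtain z where z: "z \<in> K" "x = z \<or> x = (a - z) \<union> (z - a)" using x by blast
    obtain w where w: "w \<in> K" "y = w \<or> y = (a - w) \<union> (w - a)" using y by blast
    define t where "t = (\<lambda>z. (a - z) \<union> (z - a))"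
    have "x \<otimes>\<^bsub>parity_group n\<^esub> y = (z - w) \<union> (w - z) \<or>
      x \<otimes>\<^bsub>parity_group n\<^esub> y = t ((z - w) \<union> (w - z))"
      unfolding parity_group_simps t_def using z(2) w(2) by (elim disjE) (simp_all, blast+)
    hence "x \<otimes>\<^bsub>parity_group n\<^esub> y \<in> K \<union> t ` K" using K [OF z(1) w(1)] by (elim disjE) simp_all
    thus "x \<otimes>\<^bsub>parity_group n\<^esub> y \<in> K \<union> (\<lambda>z. (a - z) \<union> (z - a)) ` K"
      unfolding t_def .
  qed
qed

text \<open>Each new generator at most doubles the subgroup. Comparison with the order 2^n then
  gives the rank by counting, without linear algebra.\<close>

lemma parity_group_generate_bound:
  assumes "finite S" "S \<subseteq> Pow {..<n}"
  shows "\<exists>K. subgroup K (parity_group n) \<and> S \<subseteq> K \<and> finite K \<and> card K \<le> 2 ^ card S"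
  using assms
proof (induction S rule: finite_induct)
  case empty
  show ?case using group.triv_subgroup [OF group_parity_group] by (intro exI [of _ "{{}}"]) auto
next
  case (insert a S)
  then obtain K where K: "subgroup K (parity_group n)" "S \<subseteq> K" "finite K" "card K \<le> 2 ^ card S"
    by auto
  let ?K = "K \<union> (\<lambda>z. (a - z) \<union> (z - a)) ` K"
  have "{} \<in> K" using subgroup.one_closed [OF K(1)] by simp
  hence "a \<in> ?K" by force
  moreover have "card ?K \<le> 2 ^ card (insert a S)"
  proof -
    have "card ?K \<le> card K + card ((\<lambda>z. (a - z) \<union> (z - a)) ` K)" by (rule card_Un_le)
    also have "\<dots> \<le> card K + card K" using K(3) by (intro add_mono card_image_le) auto
    finally show ?thesis using K(4) insert by simp
  qed
  ultimately show ?case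
    using subgroup_parity_group_insert [OF K(1), of a] insert.prems K by (intro exI [of _ ?K]) auto
qed

lemma parity_group_rank:
  assumes "finite S" "S \<subseteq> Pow {..<n}" "generate (parity_group n) S = Pow {..<n}"
  shows "n \<le> card S"
proof -
  interpret group "parity_group n" by (rule group_parity_group)
  obtain K where K: "subgroup K (parity_group n)" "S \<subseteq> K" "finite K" "card K \<le> 2 ^ card S"
    using parity_group_generate_bound [OF assms(1,2)] by blast
  have "Pow {..<n} \<subseteq> K" using generate_subgroup_incl [OF K(2,1)] assms(3) by simp
  hence "card (Pow {..<n}) \<le> card K" using K(3) by (rule card_mono [rotated])
  hence "card (Pow {..<n}) \<le> 2 ^ card S" using K(4) by (rule order_trans)
  hence "(2::nat) ^ n \<le> 2 ^ card S" by (simp only: card_Pow finite_lessThan card_lessThan)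
  thus ?thesis by simp
qed

text \<open>Elementwise form of: two nontrivial normal subgroups never commute. Commutators of
  normal subgroups play the part of products of ideals, and the trivial subgroup that of a prime
  ideal.\<close>

definition conj_prime :: "('a, 'b) monoid_scheme \<Rightarrow> bool" where
  "conj_prime Q \<longleftrightarrow> (\<forall>x\<in>carrier Q. \<forall>y\<in>carrier Q. x \<noteq> \<one>\<^bsub>Q\<^esub> \<longrightarrow> y \<noteq> \<one>\<^bsub>Q\<^esub> \<longrightarrow>
     (\<exists>h\<in>carrier Q. x \<otimes>\<^bsub>Q\<^esub> (h \<otimes>\<^bsub>Q\<^esub> y \<otimes>\<^bsub>Q\<^esub> inv\<^bsub>Q\<^esub> h) \<noteq> (h \<otimes>\<^bsub>Q\<^esub> y \<otimes>\<^bsub>Q\<^esub> inv\<^bsub>Q\<^esub> h) \<otimes>\<^bsub>Q\<^esub> x))"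

lemma conj_prime_sym_group:
  assumes "5 \<le> n"
  shows "conj_prime (sym_group n)"
  unfolding conj_prime_def
proof (intro ballI impI)
  fix x y assume xy: "x \<in> carrier (sym_group n)" "y \<in> carrier (sym_group n)"
    "x \<noteq> \<one>\<^bsub>sym_group n\<^esub>" "y \<noteq> \<one>\<^bsub>sym_group n\<^esub>"
  obtain h where h: "h permutes {1..n}" "x \<circ> (h \<circ> y \<circ> inv' h) \<noteq> (h \<circ> y \<circ> inv' h) \<circ> x"
    by (rule permutes_noncommuting_conjugate [of "{1..n}" x y])
      (use xy assms in \<open>auto simp: sym_group_carrier sym_group_one\<close>)
  hence "h \<in> carrier (sym_group n)" by (simp add: sym_group_carrier)
  thus "\<exists>h\<in>carrier (sym_group n). x \<otimes>\<^bsub>sym_group n\<^esub> (h \<otimes>\<^bsub>sym_group n\<^esub> y \<otimes>\<^bsub>sym_group n\<^esub> inv\<^bsub>sym_group n\<^esub> h)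
      \<noteq> (h \<otimes>\<^bsub>sym_group n\<^esub> y \<otimes>\<^bsub>sym_group n\<^esub> inv\<^bsub>sym_group n\<^esub> h) \<otimes>\<^bsub>sym_group n\<^esub> x"
    using h by (intro bexI [of _ h]) (simp_all add: sym_group_mult)
qed

locale prime_surjections = group F for F (structure) +
  fixes Q :: "('q, 'r) monoid_scheme" and D
  assumes Q: "group Q" "finite (carrier Q)" "conj_prime Q"
    and D: "D \<lhd> F"
begin

text \<open>The last clause says that D is not inside the kernel; it starts the induction over sets
  of kernels, where the empty intersection is D itself.\<close>

definition admissible :: "('a \<Rightarrow> 'q) \<Rightarrow> bool" where
  "admissible \<rho> \<longleftrightarrow> group_hom F Q \<rho> \<and> \<rho> ` carrier F = carrier Q \<and> (\<exists>d\<in>D. \<rho> d \<noteq> \<one>\<^bsub>Q\<^esub>)"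

lemma admissible_noncommuting:
  assumes "admissible \<rho>" "a \<in> carrier Q" "a \<noteq> \<one>\<^bsub>Q\<^esub>" "l \<in> carrier F" "\<rho> l \<noteq> \<one>\<^bsub>Q\<^esub>"
  obtains f where "f \<in> carrier F"
    "a \<otimes>\<^bsub>Q\<^esub> \<rho> (f \<otimes> l \<otimes> inv f) \<noteq> \<rho> (f \<otimes> l \<otimes> inv f) \<otimes>\<^bsub>Q\<^esub> a"
proof -
  interpret r: group_hom F Q \<rho> using assms(1) by (simp add: admissible_def)
  have "\<rho> l \<in> carrier Q" using assms(4) by simp
  then obtain h where h: "h \<in> carrier Q"
    "a \<otimes>\<^bsub>Q\<^esub> (h \<otimes>\<^bsub>Q\<^esub> \<rho> l \<otimes>\<^bsub>Q\<^esub> inv\<^bsub>Q\<^esub> h) \<noteq> (h \<otimes>\<^bsub>Q\<^esub> \<rho> l \<otimes>\<^bsub>Q\<^esub> inv\<^bsub>Q\<^esub> h) \<otimes>\<^bsub>Q\<^esub> a"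
    using Q(3) assms(2,3,5) unfolding conj_prime_def by blast
  obtain f where f: "f \<in> carrier F" "h = \<rho> f" using h(1) assms(1) by (auto simp: admissible_def)
  have "\<rho> (f \<otimes> l \<otimes> inv f) = h \<otimes>\<^bsub>Q\<^esub> \<rho> l \<otimes>\<^bsub>Q\<^esub> inv\<^bsub>Q\<^esub> h"
    using f assms(4) by simp
  thus ?thesis using that [OF f(1)] h(2) by simp
qed

text \<open>The inclusion makes \<sigma> factor through \<rho> by a surjective endomorphism of Q,
  which is injective since Q is finite. Distinct kernels are therefore incomparable.\<close>

lemma kernel_inclusion_eq:
  assumes r: "admissible \<rho>" and s: "admissible \<sigma>"
    and sub: "\<And>x. x \<in> carrier F \<Longrightarrow> \<rho> x = \<one>\<^bsub>Q\<^esub> \<Longrightarrow> \<sigma> x = \<one>\<^bsub>Q\<^esub>"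
    and x: "x \<in> carrier F" "\<sigma> x = \<one>\<^bsub>Q\<^esub>"
  shows "\<rho> x = \<one>\<^bsub>Q\<^esub>"
proof -
  obtain w where w: "group_hom Q Q w" "\<And>x. x \<in> carrier F \<Longrightarrow> w (\<rho> x) = \<sigma> x"
    using group_hom_factor [of F Q \<rho> Q \<sigma>] r s sub unfolding admissible_def by blast
  interpret w: group_hom Q Q w by (rule w)
  have "w ` (\<rho> ` carrier F) = \<sigma> ` carrier F" using w(2) by (auto simp: image_image)
  hence "w ` carrier Q = carrier Q" using r s by (simp add: admissible_def)
  hence "inj_on w (carrier Q)" using Q(2) by (simp add: eq_card_imp_inj_on)
  moreover have "w (\<rho> x) = w \<one>\<^bsub>Q\<^esub>" "\<rho> x \<in> carrier Q" using w(2) x r by (auto simp: admissible_def)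
  ultimately show ?thesis by (auto simp: inj_on_def)
qed

text \<open>Kernels of admissible maps behave like prime ideals: an intersection of normal subgroups lies
  in such a kernel only if one of them does.\<close>
lemma common_kernel_element:
  assumes "finite T" "\<forall>\<rho>\<in>T. admissible \<rho>" "admissible \<sigma>"
    and "\<forall>\<rho>\<in>T. \<exists>x\<in>carrier F. \<rho> x = \<one>\<^bsub>Q\<^esub> \<and> \<sigma> x \<noteq> \<one>\<^bsub>Q\<^esub>"
  shows "\<exists>l\<in>D. (\<forall>\<rho>\<in>T. \<rho> l = \<one>\<^bsub>Q\<^esub>) \<and> \<sigma> l \<noteq> \<one>\<^bsub>Q\<^esub>"
  using assms(1,2,4)
proof (induction T rule: finite_induct)
  case empty
  then show ?case using assms(3) by (auto simp: admissible_def)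
next
  case (insert \<rho> T)
  interpret D: normal D F by (rule D)
  interpret s: group_hom F Q \<sigma> using assms(3) by (simp add: admissible_def)
  obtain l where l: "l \<in> D" "\<forall>\<rho>\<in>T. \<rho> l = \<one>\<^bsub>Q\<^esub>" "\<sigma> l \<noteq> \<one>\<^bsub>Q\<^esub>"
    using insert by auto
  obtain k where k: "k \<in> carrier F" "\<rho> k = \<one>\<^bsub>Q\<^esub>" "\<sigma> k \<noteq> \<one>\<^bsub>Q\<^esub>"
    using insert by auto
  \<comment> \<open>The new element is the commutator of l with f k f^-1. It dies under T because l
    does and under \<rho> because k does; the choice of f keeps it alive under \<sigma>.\<close>
  obtain f where f: "f \<in> carrier F"
    "\<sigma> l \<otimes>\<^bsub>Q\<^esub> \<sigma> (f \<otimes> k \<otimes> inv f) \<noteq> \<sigma> (f \<otimes> k \<otimes> inv f) \<otimes>\<^bsub>Q\<^esub> \<sigma> l"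
    using admissible_noncommuting [OF assms(3), of "\<sigma> l" k] l k by auto
  define c where "c = f \<otimes> k \<otimes> inv f"
  have [simp]: "c \<in> carrier F" using f k by (simp add: c_def)
  have lF [simp]: "l \<in> carrier F" using l by simp
  \<comment> \<open>Only l is known to lie in D; normality supplies the rest of [l, c].\<close>
  have "l \<otimes> (c \<otimes> inv l \<otimes> inv c) \<in> D"
    using l(1) by (intro D.m_closed D.inv_op_closed2 D.m_inv_closed) auto
  hence "commutator F l c \<in> D" by (simp add: commutator_def m_assoc)
  moreover have "\<rho>' (commutator F l c) = \<one>\<^bsub>Q\<^esub>" if "\<rho>' \<in> insert \<rho> T" for \<rho>'
  proof -
    interpret r: group_hom F Q \<rho>' using that insert.prems by (auto simp: admissible_def)
    have "\<rho>' l = \<one>\<^bsub>Q\<^esub> \<or> \<rho>' k = \<one>\<^bsub>Q\<^esub>" using that l(2) k(2) by auto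
    hence "\<rho>' l = \<one>\<^bsub>Q\<^esub> \<or> \<rho>' c = \<one>\<^bsub>Q\<^esub>" using k(1) f(1) by (auto simp: c_def)
    thus ?thesis by (auto simp: r.hom_commutator s.H.commutator_eq_one_iff)
  qed
  moreover have "\<sigma> (commutator F l c) \<noteq> \<one>\<^bsub>Q\<^esub>"
    using f(2) by (simp add: s.hom_commutator s.H.commutator_eq_one_iff c_def [symmetric])
  ultimately show ?case by blast
qed

lemma eval_commutator_word:
  assumes "group H" "h 0 \<in> carrier H" "h 1 \<in> carrier H"
    and "\<And>i. i < n \<Longrightarrow> h i \<in> carrier H" "v \<in> lists (letters n)"
  shows "eval_word H h ([(0, False), (1, False), (0, True), (1, True)] @ v) =
    commutator H (h 0) (h 1) \<otimes>\<^bsub>H\<^esub> eval_word H h v"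
proof -
  interpret H: group H by fact
  have "eval_word H h v \<in> carrier H" by (rule H.eval_word_closed [OF _ assms(5)]) (rule assms(4))
  thus ?thesis using assms by (simp add: commutator_def H.m_assoc)
qed

text \<open>If the current words solve the equation under \<open>\<sigma>\<close>, they are perturbed by elements which
  are invisible to the maps already treated; only the first commutator changes.\<close>
lemma perturb:
  assumes "finite T" "\<forall>\<rho>\<in>T. admissible \<rho>" "admissible \<sigma>"
    and "\<forall>\<rho>\<in>T. \<exists>x\<in>carrier F. \<rho> x = \<one>\<^bsub>Q\<^esub> \<and> \<sigma> x \<noteq> \<one>\<^bsub>Q\<^esub>"
    and a: "a \<in> carrier F" and b: "b \<in> carrier F"
  obtains d e where "d \<in> D" "e \<in> D" "\<forall>\<rho>\<in>T. \<rho> d = \<one>\<^bsub>Q\<^esub> \<and> \<rho> e = \<one>\<^bsub>Q\<^esub>"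
    "commutator Q (\<sigma> (a \<otimes> d)) (\<sigma> (b \<otimes> e)) \<noteq> commutator Q (\<sigma> a) (\<sigma> b)"
proof -
  interpret D: normal D F by (rule D)
  interpret s: group_hom F Q \<sigma> using assms(3) by (simp add: admissible_def)
  obtain l where l: "l \<in> D" "\<forall>\<rho>\<in>T. \<rho> l = \<one>\<^bsub>Q\<^esub>" "\<sigma> l \<noteq> \<one>\<^bsub>Q\<^esub>"
    using common_kernel_element [OF assms(1-4)] by blast
  have [simp]: "l \<in> carrier F" using l by simp
  have one: "\<forall>\<rho>\<in>T. \<rho> \<one> = \<one>\<^bsub>Q\<^esub>"
    using assms(2) by (auto simp: admissible_def intro: group_hom.hom_one)
  have conj: "f \<otimes> l \<otimes> inv f \<in> D" "\<forall>\<rho>\<in>T. \<rho> (f \<otimes> l \<otimes> inv f) = \<one>\<^bsub>Q\<^esub>" if f: "f \<in> carrier F" for f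
  proof -
    show "f \<otimes> l \<otimes> inv f \<in> D" using f l(1) by (rule D.inv_op_closed2)
    show "\<forall>\<rho>\<in>T. \<rho> (f \<otimes> l \<otimes> inv f) = \<one>\<^bsub>Q\<^esub>"
    proof
      fix \<rho> assume "\<rho> \<in> T"
      then interpret r: group_hom F Q \<rho> using assms(2) by (simp add: admissible_def)
      show "\<rho> (f \<otimes> l \<otimes> inv f) = \<one>\<^bsub>Q\<^esub>" using f bspec [OF l(2) \<open>\<rho> \<in> T\<close>] by simp
    qed
  qed
  \<comment> \<open>The conjugates of the single element l suffice: they stay in D and in all
    kernels of T, and some conjugate fails to commute with a given q \<noteq> 1 under
    \<sigma>.\<close>
  have noncomm: "\<exists>m\<in>D. (\<forall>\<rho>\<in>T. \<rho> m = \<one>\<^bsub>Q\<^esub>) \<and> \<sigma> m \<otimes>\<^bsub>Q\<^esub> q \<noteq> q \<otimes>\<^bsub>Q\<^esub> \<sigma> m"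
    if q: "q \<in> carrier Q" "q \<noteq> \<one>\<^bsub>Q\<^esub>" for q
  proof -
    obtain f where f: "f \<in> carrier F"
      "q \<otimes>\<^bsub>Q\<^esub> \<sigma> (f \<otimes> l \<otimes> inv f) \<noteq> \<sigma> (f \<otimes> l \<otimes> inv f) \<otimes>\<^bsub>Q\<^esub> q"
      by (rule admissible_noncommuting [OF assms(3) q, of l]) (use l in auto)
    show ?thesis
      by (rule bexI [of _ "f \<otimes> l \<otimes> inv f"]) (use conj [OF f(1)] f(2) in metis)+
  qed
  \<comment> \<open>If \<sigma>(b) is nontrivial, a is changed by an m not commuting with b under
    \<sigma>, and symmetrically for a. If both are trivial, one change leaves the commutator
    trivial, so both entries are changed, to m and l.\<close>
  consider "\<sigma> b \<noteq> \<one>\<^bsub>Q\<^esub>" | "\<sigma> a \<noteq> \<one>\<^bsub>Q\<^esub>" | "\<sigma> a = \<one>\<^bsub>Q\<^esub>" "\<sigma> b = \<one>\<^bsub>Q\<^esub>" by blast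
  thus ?thesis
  proof cases
    case 1
    then obtain m where m: "m \<in> D" "\<forall>\<rho>\<in>T. \<rho> m = \<one>\<^bsub>Q\<^esub>" "\<sigma> m \<otimes>\<^bsub>Q\<^esub> \<sigma> b \<noteq> \<sigma> b \<otimes>\<^bsub>Q\<^esub> \<sigma> m"
      using noncomm [of "\<sigma> b"] b by auto
    hence neq: "commutator Q (\<sigma> (a \<otimes> m)) (\<sigma> (b \<otimes> \<one>)) \<noteq> commutator Q (\<sigma> a) (\<sigma> b)"
      using a b by (simp add: s.H.commutator_eq_left_iff)
    show ?thesis by (rule that [OF m(1) D.one_closed _ neq]) (use m(2) one in blast)
  next
    case 2
    then obtain m where m: "m \<in> D" "\<forall>\<rho>\<in>T. \<rho> m = \<one>\<^bsub>Q\<^esub>" "\<sigma> m \<otimes>\<^bsub>Q\<^esub> \<sigma> a \<noteq> \<sigma> a \<otimes>\<^bsub>Q\<^esub> \<sigma> m"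
      using noncomm [of "\<sigma> a"] a by auto
    hence neq: "commutator Q (\<sigma> (a \<otimes> \<one>)) (\<sigma> (b \<otimes> m)) \<noteq> commutator Q (\<sigma> a) (\<sigma> b)"
      using a b by (simp add: s.H.commutator_eq_right_iff)
    show ?thesis by (rule that [OF D.one_closed m(1) _ neq]) (use m(2) one in blast)
  next
    case 3
    obtain m where m: "m \<in> D" "\<forall>\<rho>\<in>T. \<rho> m = \<one>\<^bsub>Q\<^esub>" "\<sigma> m \<otimes>\<^bsub>Q\<^esub> \<sigma> l \<noteq> \<sigma> l \<otimes>\<^bsub>Q\<^esub> \<sigma> m"
      using noncomm [of "\<sigma> l"] l by auto
    hence "commutator Q (\<sigma> m) (\<sigma> l) \<noteq> \<one>\<^bsub>Q\<^esub>" by (simp add: s.H.commutator_eq_one_iff)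
    moreover have "commutator Q \<one>\<^bsub>Q\<^esub> \<one>\<^bsub>Q\<^esub> = \<one>\<^bsub>Q\<^esub>" by (simp add: s.H.commutator_eq_one_iff)
    ultimately have neq: "commutator Q (\<sigma> (a \<otimes> m)) (\<sigma> (b \<otimes> l)) \<noteq> commutator Q (\<sigma> a) (\<sigma> b)"
      using a b m(1) 3 by simp
    show ?thesis by (rule that [OF m(1) l(1) _ neq]) (use m(2) l(2) in blast)
  qed
qed

text \<open>Induction on T. A map \<sigma> that already avoids 1 needs no change. Otherwise the
  words are perturbed inside the kernels of the earlier maps, so that nothing achieved is lost.
  Staying in x_i D keeps the endomorphism trivial on the abelianization when D is
  \<gamma>_2(F).\<close>

lemma exists_avoiding_words:
  assumes "finite T" "\<forall>\<rho>\<in>T. admissible \<rho>"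
    and x: "\<And>i. i < n \<Longrightarrow> x i \<in> carrier F" and n: "2 \<le> n"
    and v: "v \<in> lists (letters n)" "\<And>l. l \<in> set v \<Longrightarrow> 2 \<le> fst l"
    and w: "w = [(0, False), (1, False), (0, True), (1, True)] @ v"
  shows "\<exists>u. (\<forall>i<n. u i \<in> carrier F \<and> inv (x i) \<otimes> u i \<in> D) \<and>
    (\<forall>\<rho>\<in>T. eval_word Q (\<lambda>i. \<rho> (u i)) w \<noteq> \<one>\<^bsub>Q\<^esub>)"
  using assms(1,2)
proof (induction T rule: finite_induct)
  case empty
  interpret D: normal D F by (rule D)
  show ?case using x by (intro exI [of _ x]) simp
next
  case (insert \<sigma> T)
  interpret D: normal D F by (rule D)
  obtain u where u: "\<And>i. i < n \<Longrightarrow> u i \<in> carrier F" "\<And>i. i < n \<Longrightarrow> inv (x i) \<otimes> u i \<in> D"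
    "\<forall>\<rho>\<in>T. eval_word Q (\<lambda>i. \<rho> (u i)) w \<noteq> \<one>\<^bsub>Q\<^esub>"
    using insert by auto
  have s: "admissible \<sigma>" and T: "\<forall>\<rho>\<in>T. admissible \<rho>" using insert.prems by auto
  interpret s: group_hom F Q \<sigma> using s by (simp add: admissible_def)
  show ?case
  proof (cases "eval_word Q (\<lambda>i. \<sigma> (u i)) w = \<one>\<^bsub>Q\<^esub>")
    case False
    then show ?thesis using u by (intro exI [of _ u]) auto
  next
    case True
    have wl: "w \<in> lists (letters n)" using v n unfolding w by (auto simp: letters_def)
    \<comment> \<open>The value w(u) lies in the kernel of \<sigma> but not in that of \<rho>. If
      the kernel of \<rho> were inside that of \<sigma>, the two would coincide, which is
      absurd.\<close>
    have "\<exists>x\<in>carrier F. \<rho> x = \<one>\<^bsub>Q\<^esub> \<and> \<sigma> x \<noteq> \<one>\<^bsub>Q\<^esub>" if r: "\<rho> \<in> T" for \<rho>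
    proof (rule ccontr)
      assume not: "\<not> ?thesis"
      interpret r: group_hom F Q \<rho> using r T by (simp add: admissible_def)
      have E: "eval_word F u w \<in> carrier F" by (rule eval_word_closed [OF u(1) wl])
      have "\<sigma> (eval_word F u w) = \<one>\<^bsub>Q\<^esub>" using s.hom_eval_word [OF u(1) wl] True by simp
      hence "\<rho> (eval_word F u w) = \<one>\<^bsub>Q\<^esub>"
        using kernel_inclusion_eq [of \<rho> \<sigma> "eval_word F u w"] not r T s E by blast
      thus False using r.hom_eval_word [OF u(1) wl] u(3) r by simp
    qed
    then obtain d e where de: "d \<in> D" "e \<in> D" "\<forall>\<rho>\<in>T. \<rho> d = \<one>\<^bsub>Q\<^esub> \<and> \<rho> e = \<one>\<^bsub>Q\<^esub>"
      and neq: "commutator Q (\<sigma> (u 0 \<otimes> d)) (\<sigma> (u 1 \<otimes> e)) \<noteq> commutator Q (\<sigma> (u 0)) (\<sigma> (u 1))"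
      using perturb [OF insert.hyps(1) T s, of "u 0" "u 1"] u(1) n by auto
    define u' where "u' = u(0 := u 0 \<otimes> d, 1 := u 1 \<otimes> e)"
    have u': "u' i \<in> carrier F" if "i < n" for i
      using that u(1) n de by (auto simp: u'_def)
    have "inv (x i) \<otimes> u' i \<in> D" if i: "i < n" for i
    proof -
      have "u' i = u i \<otimes> d \<or> u' i = u i \<otimes> e \<or> u' i = u i" by (auto simp: u'_def)
      moreover have "inv (x i) \<otimes> (u i \<otimes> c) \<in> D" if "c \<in> D" for c
        using D.m_closed [OF u(2) [OF i] that] x [OF i] u(1) [OF i] that by (simp add: m_assoc)
      ultimately show ?thesis using de(1,2) u(2) [OF i] by metis
    qed
    moreover have "eval_word Q (\<lambda>i. \<rho> (u' i)) w \<noteq> \<one>\<^bsub>Q\<^esub>" if r: "\<rho> \<in> T" for \<rho>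
    proof -
      interpret r: group_hom F Q \<rho> using r T by (simp add: admissible_def)
      have "eval_word Q (\<lambda>i. \<rho> (u' i)) w = eval_word Q (\<lambda>i. \<rho> (u i)) w"
        using de(1,2) bspec [OF de(3) r] u(1) n
        by (intro eval_word_cong) (auto simp: u'_def)
      thus ?thesis using u(3) r by simp
    qed
    moreover have "eval_word Q (\<lambda>i. \<sigma> (u' i)) w \<noteq> \<one>\<^bsub>Q\<^esub>"
    proof
      assume "eval_word Q (\<lambda>i. \<sigma> (u' i)) w = \<one>\<^bsub>Q\<^esub>"
      moreover have "eval_word Q (\<lambda>i. \<sigma> (u' i)) w =
        commutator Q (\<sigma> (u' 0)) (\<sigma> (u' 1)) \<otimes>\<^bsub>Q\<^esub> eval_word Q (\<lambda>i. \<sigma> (u' i)) v"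
        unfolding w by (rule eval_commutator_word [OF Q(1) _ _ _ v(1)]) (use u' n in auto)
      \<comment> \<open>The tail only has letters of index at least 2, so the perturbation of u_0
        and u_1 cannot be compensated there.\<close>
      moreover have "eval_word Q (\<lambda>i. \<sigma> (u' i)) v = eval_word Q (\<lambda>i. \<sigma> (u i)) v"
        using v(2) by (intro eval_word_cong) (force simp: u'_def)
      moreover have "eval_word Q (\<lambda>i. \<sigma> (u i)) w =
        commutator Q (\<sigma> (u 0)) (\<sigma> (u 1)) \<otimes>\<^bsub>Q\<^esub> eval_word Q (\<lambda>i. \<sigma> (u i)) v"
        unfolding w by (rule eval_commutator_word [OF Q(1) _ _ _ v(1)]) (use u n in auto)
      moreover have "eval_word Q (\<lambda>i. \<sigma> (u i)) v \<in> carrier Q"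
        by (rule s.H.eval_word_closed [OF _ v(1)]) (use u in auto)
      moreover have "u 0 \<in> carrier F" "u 1 \<in> carrier F" "u' 0 \<in> carrier F" "u' 1 \<in> carrier F"
        using u(1) u' n by auto
      ultimately have "commutator Q (\<sigma> (u' 0)) (\<sigma> (u' 1)) = commutator Q (\<sigma> (u 0)) (\<sigma> (u 1))"
        using True by (metis s.H.commutator_closed s.H.r_cancel s.hom_closed)
      thus False using neq by (simp add: u'_def)
    qed
    ultimately show ?thesis using u' by (intro exI [of _ u']) auto
  qed
qed

end

section \<open>Surface groups\<close>

text \<open>A homomorphism is determined by the images of the n generators. Extensionality makes
  this true of the HOL functions, whose values off the carrier would otherwise be arbitrary.\<close>

lemma finite_surjections:
  assumes "finite (carrier Q)"
  shows "finite {\<rho> \<in> extensional (carrier (presented_group n R)). group_hom (presented_group n R) Q \<rho>}"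
    (is "finite ?T")
proof (rule inj_on_finite)
  let ?P = "presented_group n R"
  let ?r = "\<lambda>\<rho>. restrict (\<lambda>i. \<rho> (pres_gen n R i)) {..<n}"
  show "finite ({..<n} \<rightarrow>\<^sub>E carrier Q)" using assms by (intro finite_PiE) auto
  show "?r ` ?T \<subseteq> {..<n} \<rightarrow>\<^sub>E carrier Q"
  proof (rule image_subsetI)
    fix \<rho> assume "\<rho> \<in> ?T"
    then interpret group_hom ?P Q \<rho> by simp
    show "?r \<rho> \<in> {..<n} \<rightarrow>\<^sub>E carrier Q" by (auto simp: restrict_PiE_iff pres_gen_closed)
  qed
  show "inj_on ?r ?T"
  proof (rule inj_onI)
    fix \<rho> \<sigma> assume r: "\<rho> \<in> ?T" and s: "\<sigma> \<in> ?T" and eq: "?r \<rho> = ?r \<sigma>"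
    have "{x \<in> carrier ?P. \<rho> x = \<sigma> x} = carrier ?P"
    proof (rule subgroup_presented_group_eq_carrier)
      show "subgroup {x \<in> carrier ?P. \<rho> x = \<sigma> x} ?P"
        using r s by (intro group.equalizer_subgroup group_presented_group) auto
      show "pres_gen n R i \<in> {x \<in> carrier ?P. \<rho> x = \<sigma> x}" if "i < n" for i
        using that pres_gen_closed [OF that] fun_cong [OF eq, of i] by simp
    qed
    thus "\<rho> = \<sigma>" using r s by (intro extensionalityI [of _ "carrier ?P"]) auto
  qed
qed

text \<open>Applied to the pair q, q, primality gives a conjugate of q that does not commute with q;
  lifting both to F yields the required commutator.\<close>

lemma conj_prime_derived_not_in_kernel:
  assumes "group_hom F Q \<rho>" "\<rho> ` carrier F = carrier Q" "conj_prime Q"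
    and q: "q \<in> carrier Q" "q \<noteq> \<one>\<^bsub>Q\<^esub>"
  shows "\<exists>d\<in>lower_central F (Suc (Suc 0)). \<rho> d \<noteq> \<one>\<^bsub>Q\<^esub>"
proof -
  interpret r: group_hom F Q \<rho> by fact
  obtain h where h: "h \<in> carrier Q" and
    nc: "q \<otimes>\<^bsub>Q\<^esub> (h \<otimes>\<^bsub>Q\<^esub> q \<otimes>\<^bsub>Q\<^esub> inv\<^bsub>Q\<^esub> h) \<noteq> (h \<otimes>\<^bsub>Q\<^esub> q \<otimes>\<^bsub>Q\<^esub> inv\<^bsub>Q\<^esub> h) \<otimes>\<^bsub>Q\<^esub> q"
    using assms(3) q unfolding conj_prime_def by blast
  have "h \<otimes>\<^bsub>Q\<^esub> q \<otimes>\<^bsub>Q\<^esub> inv\<^bsub>Q\<^esub> h \<in> carrier Q" using h q by simp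
  then obtain a b where ab: "a \<in> carrier F" "q = \<rho> a" "b \<in> carrier F" "h \<otimes>\<^bsub>Q\<^esub> q \<otimes>\<^bsub>Q\<^esub> inv\<^bsub>Q\<^esub> h = \<rho> b"
    using q(1) unfolding assms(2) [symmetric] by blast
  have "\<rho> (commutator F a b) \<noteq> \<one>\<^bsub>Q\<^esub>"
    using nc ab by (simp add: r.hom_commutator r.H.commutator_eq_one_iff)
  moreover have "commutator F a b \<in> lower_central F (Suc (Suc 0))"
    using ab by (intro r.G.commutator_in_lower_central) auto
  ultimately show ?thesis by blast
qed

lemma surface_relator_in_lists: "surface_relator g \<in> lists (letters (2 * g))"
  by (auto simp: surface_relator_def letters_def)

lemma surface_relator_split:
  assumes "1 \<le> g"
  obtains v where "surface_relator g = [(0, False), (1, False), (0, True), (1, True)] @ v"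
    "v \<in> lists (letters (2 * g))" "\<And>l. l \<in> set v \<Longrightarrow> 2 \<le> fst l"
proof
  let ?v = "concat (map (\<lambda>k. [(2*k, False), (2*k+1, False), (2*k, True), (2*k+1, True)]) [1..<g])"
  show eq: "surface_relator g = [(0, False), (1, False), (0, True), (1, True)] @ ?v"
    using assms by (simp add: surface_relator_def upt_conv_Cons)
  show "?v \<in> lists (letters (2 * g))"
    using surface_relator_in_lists [of g] unfolding eq by simp
  show "2 \<le> fst l" if "l \<in> set ?v" for l using that by auto
qed

lemma eval_surface_relator_commuting:
  assumes "group H" "\<And>i. i < 2 * g \<Longrightarrow> h i \<in> carrier H"
    and comm: "\<And>k. k < g \<Longrightarrow> h (2 * k) \<otimes>\<^bsub>H\<^esub> h (2 * k + 1) = h (2 * k + 1) \<otimes>\<^bsub>H\<^esub> h (2 * k)"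
  shows "eval_word H h (surface_relator g) = \<one>\<^bsub>H\<^esub>"
proof -
  interpret group H by fact
  \<comment> \<open>The range \<open>[0..<g]\<close> is generalized to an arbitrary list of indices
    to make the induction possible.\<close>
  have "eval_word H h (concat (map (\<lambda>k. [(2*k, False), (2*k+1, False), (2*k, True), (2*k+1, True)]) ks)) = \<one>\<^bsub>H\<^esub>"
    if "set ks \<subseteq> {..<g}" for ks
    using that
  proof (induction ks)
    case (Cons k ks)
    have k: "h (2 * k) \<in> carrier H" "h (2 * k + 1) \<in> carrier H" using Cons.prems assms(2) by auto
    have "commutator H (h (2 * k)) (h (2 * k + 1)) = \<one>\<^bsub>H\<^esub>"
      using k comm [of k] Cons.prems by (simp add: commutator_eq_one_iff)
    thus ?case using k Cons by (simp add: commutator_def m_assoc)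
  qed simp
  thus ?thesis unfolding surface_relator_def by (simp add: atLeast_upt)
qed

lemma group_surface_group: "group (surface_group g)"
  by (simp add: surface_group_def group_presented_group)

text \<open>Killing each [a_k, b_k] separately is stronger than the relator demands, but it covers
  both targets: S_5 and (Z/2)^(2g).\<close>

lemma surface_group_lift:
  assumes "group H" and h: "\<And>i. i < 2 * g \<Longrightarrow> h i \<in> carrier H"
    and "\<And>k. k < g \<Longrightarrow> h (2 * k) \<otimes>\<^bsub>H\<^esub> h (2 * k + 1) = h (2 * k + 1) \<otimes>\<^bsub>H\<^esub> h (2 * k)"
  obtains f where "group_hom (surface_group g) H f"
    "\<And>i. i < 2 * g \<Longrightarrow> f (pres_gen (2 * g) {surface_relator g} i) = h i"
proof -
  have rel: "eval_word H h r = \<one>\<^bsub>H\<^esub>" if "r \<in> {surface_relator g}" "r \<in> lists (letters (2 * g))" for r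
    using that(1) eval_surface_relator_commuting [OF assms] by simp
  show ?thesis
    by (rule presented_group_lift [of H "2 * g" h "{surface_relator g}", OF assms(1) h rel])
      (use that in \<open>auto simp: surface_group_def\<close>)
qed

lemma surface_group_onto_sym_group:
  assumes "2 \<le> g"
  obtains f where "group_hom (surface_group g) (sym_group 5) f"
    "f ` carrier (surface_group g) = carrier (sym_group 5)"
proof -
  \<comment> \<open>The four adjacent transpositions of S_5 are split into the disjoint, hence
    commuting, pairs (12), (34) and (23), (45). Two handles are needed to accommodate them; the
    remaining generators go to the identity.\<close>
  define h where "h i = (if i = 0 then Transposition.transpose 1 (2 :: nat)
    else if i = 1 then Transposition.transpose 3 4
    else if i = 2 then Transposition.transpose 2 3
    else if i = 3 then Transposition.transpose 4 5 else id)" for i :: nat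
  have h: "h i \<in> carrier (sym_group 5)" for i
    by (auto simp: h_def sym_group_carrier intro!: permutes_swap_id permutes_id)
  have comm: "h (2 * k) \<otimes>\<^bsub>sym_group 5\<^esub> h (2 * k + 1) = h (2 * k + 1) \<otimes>\<^bsub>sym_group 5\<^esub> h (2 * k)" for k
  proof -
    consider "k = 0" | "k = 1" | "2 \<le> k" by linarith
    thus ?thesis
      by cases (auto simp: h_def sym_group_mult fun_eq_iff Transposition.transpose_def)
  qed
  obtain f where f: "group_hom (surface_group g) (sym_group 5) f"
    "\<And>i. i < 2 * g \<Longrightarrow> f (pres_gen (2 * g) {surface_relator g} i) = h i"
    by (rule surface_group_lift [of "sym_group 5" g h]) (use sym_group_is_group h comm in auto)
  interpret f: group_hom "surface_group g" "sym_group 5" f by (rule f)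
  have mem: "h i \<in> f ` carrier (surface_group g)" if "i < 4" for i
  proof -
    have "i < 2 * g" using that assms by simp
    thus ?thesis using f(2) [of i] pres_gen_closed [of i "2 * g" "{surface_relator g}"]
      by (metis imageI surface_group_def)
  qed
  have "f ` carrier (surface_group g) = carrier (sym_group 5)"
  proof (rule sym_group_generated_by_adjacent)
    show "subgroup (f ` carrier (surface_group g)) (sym_group 5)"
      by (rule f.img_is_subgroup)
    fix i :: nat assume "1 \<le> i" "i < 5"
    then consider "i = 1" | "i = 2" | "i = 3" | "i = 4" by linarith
    thus "Transposition.transpose i (Suc i) \<in> f ` carrier (surface_group g)"
      using mem [of 0] mem [of 1] mem [of 2] mem [of 3] by cases (simp_all add: h_def eval_nat_numeral)
  qed
  thus ?thesis using f(1) that by blast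
qed

lemma subgroup_parity_group_eq_carrier:
  assumes "subgroup K (parity_group n)" "\<And>i. i < n \<Longrightarrow> {i} \<in> K"
  shows "K = carrier (parity_group n)"
proof
  interpret K: subgroup K "parity_group n" by fact
  show "K \<subseteq> carrier (parity_group n)" by (rule K.subset)
  show "carrier (parity_group n) \<subseteq> K"
  proof
    fix A assume A: "A \<in> carrier (parity_group n)"
    hence "finite A" by (auto intro: finite_subset)
    thus "A \<in> K" using A
    proof (induction A)
      case empty
      show ?case using K.one_closed by simp
    next
      case (insert a A)
      have "{a} \<otimes>\<^bsub>parity_group n\<^esub> A \<in> K" using insert assms(2) by (intro K.m_closed) auto
      moreover have "{a} \<otimes>\<^bsub>parity_group n\<^esub> A = insert a A" using insert by auto
      ultimately show ?case by simp
    qed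
  qed
qed

text \<open>The images {i} are a basis of (Z/2)^n: they make the s i distinct, so n generators
  exist, and they make v surjective, so no generating set is smaller.\<close>

lemma has_rankI:
  assumes G: "group G" and s: "\<And>i. i < n \<Longrightarrow> s i \<in> carrier G"
    and gen: "generate G (s ` {..<n}) = carrier G"
    and v: "group_hom G (parity_group n) v" "\<And>i. i < n \<Longrightarrow> v (s i) = {i}"
  shows "has_rank G n"
proof -
  interpret v: group_hom G "parity_group n" v by (rule v)
  have "inj_on s {..<n}" using v(2) by (intro inj_onI) (metis lessThan_iff singleton_inject)
  hence "card (s ` {..<n}) = n" by (simp add: card_image)
  moreover have "n \<le> card S" if S: "S \<subseteq> carrier G" "finite S" "generate G S = carrier G" for S
  proof -
    have "v ` carrier G = carrier (parity_group n)"
      by (rule subgroup_parity_group_eq_carrier [OF v.img_is_subgroup]) (metis imageI s v(2))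
    hence "generate (parity_group n) (v ` S) = Pow {..<n}"
      using v.generate_img [OF S(1)] S(3) by simp
    moreover have "v ` S \<subseteq> Pow {..<n}" using S(1) v.hom_closed by auto
    ultimately have "n \<le> card (v ` S)" using S(2) by (intro parity_group_rank) auto
    thus ?thesis using card_image_le [OF S(2), of v] by linarith
  qed
  moreover have "s ` {..<n} \<subseteq> carrier G" using s by auto
  ultimately show ?thesis unfolding has_rank_def using gen by blast
qed

lemma (in group_hom) lower_central_subset_kernel:
  assumes "\<And>a b. a \<in> carrier H \<Longrightarrow> b \<in> carrier H \<Longrightarrow> a \<otimes>\<^bsub>H\<^esub> b = b \<otimes>\<^bsub>H\<^esub> a"
    and "x \<in> lower_central G (Suc (Suc 0))"
  shows "h x = \<one>\<^bsub>H\<^esub>"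
proof -
  have "{commutator G a b | a b. a \<in> carrier G \<and> b \<in> lower_central G (Suc 0)} \<subseteq> kernel G H h"
    using assms(1) by (auto simp: kernel_def hom_commutator H.commutator_eq_one_iff)
  hence "lower_central G (Suc (Suc 0)) \<subseteq> kernel G H h"
    unfolding lower_central_Suc_Suc by (rule G.generate_subgroup_incl [OF _ subgroup_kernel])
  thus ?thesis using assms(2) by (auto simp: kernel_def)
qed

text \<open>Modulo M the statement compares two homomorphisms, the projection and the projection
  after \<phi>, so equality on generators suffices.\<close>

lemma endo_id_if_on_generators:
  assumes phi: "group_hom (presented_group n R) (presented_group n R) \<phi>"
    and M: "M \<lhd> presented_group n R"
    and gen: "\<And>i. i < n \<Longrightarrow>
      inv\<^bsub>presented_group n R\<^esub> (pres_gen n R i) \<otimes>\<^bsub>presented_group n R\<^esub> \<phi> (pres_gen n R i) \<in> M"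
    and x: "x \<in> carrier (presented_group n R)"
  shows "inv\<^bsub>presented_group n R\<^esub> x \<otimes>\<^bsub>presented_group n R\<^esub> \<phi> x \<in> M"
proof -
  let ?P = "presented_group n R"
  interpret P: group ?P by (rule group_presented_group)
  interpret phi: group_hom ?P ?P \<phi> by (rule phi)
  interpret M: normal M ?P by (rule M)
  interpret p: group_hom ?P "?P Mod M" "\<lambda>x. M #>\<^bsub>?P\<^esub> x" by (rule M.group_hom_rcoset)
  have eq: "M #>\<^bsub>?P\<^esub> y = M #>\<^bsub>?P\<^esub> \<phi> y \<longleftrightarrow> inv\<^bsub>?P\<^esub> y \<otimes>\<^bsub>?P\<^esub> \<phi> y \<in> M" if "y \<in> carrier ?P" for y
    using p.hom_eq_iff [of y "\<phi> y"] M.rcoset_eq_one_iff [of "inv\<^bsub>?P\<^esub> y \<otimes>\<^bsub>?P\<^esub> \<phi> y"] that by simp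
  have "{y \<in> carrier ?P. M #>\<^bsub>?P\<^esub> y = M #>\<^bsub>?P\<^esub> \<phi> y} = carrier ?P"
  proof (rule subgroup_presented_group_eq_carrier)
    show "subgroup {y \<in> carrier ?P. M #>\<^bsub>?P\<^esub> y = M #>\<^bsub>?P\<^esub> \<phi> y} ?P"
      by (rule P.equalizer_subgroup [OF p.group_hom_axioms group_hom_compose [OF phi p.group_hom_axioms]])
    show "pres_gen n R i \<in> {y \<in> carrier ?P. M #>\<^bsub>?P\<^esub> y = M #>\<^bsub>?P\<^esub> \<phi> y}" if "i < n" for i
      using gen [OF that] pres_gen_closed [OF that] eq by simp
  qed
  thus ?thesis using x eq [OF x] by blast
qed

section \<open>The twisted quotient for the surface relator\<close>

theorem theorem1:
  fixes g :: nat
  assumes "g \<ge> 2"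
  shows "\<exists>G :: nat monoid.
           group G \<and> residually_nilpotent G \<and> has_rank G (2 * g) \<and>
           \<not> (G \<cong> surface_group g) \<and>
           (\<forall>i\<ge>1. (G Mod lower_central G i) \<cong>
                    (surface_group g Mod lower_central (surface_group g) i))"
proof -
  define n r where "n = 2 * g" and "r = surface_relator g"
  define F where "F = presented_group n {}"
  define x where "x = pres_gen n {}"
  let ?\<Gamma> = "surface_group g" and ?Q = "sym_group 5" and ?V = "parity_group n"
  have n: "2 \<le> n" using assms by (simp add: n_def)
  have rl: "r \<in> lists (letters n)" by (simp add: r_def n_def surface_relator_in_lists)
  have \<Gamma>: "?\<Gamma> = presented_group n {r}" by (simp add: surface_group_def n_def r_def)
  interpret F: group F unfolding F_def by (rule group_presented_group)
  interpret \<Gamma>: group ?\<Gamma> by (rule group_surface_group)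
  have x: "x i \<in> carrier F" if "i < n" for i
    using that by (simp add: x_def F_def pres_gen_closed)

  obtain \<pi> where \<pi>: "group_hom F ?\<Gamma> \<pi>"
    and \<pi>_word: "\<And>w. w \<in> lists (letters n) \<Longrightarrow> \<pi> (word_class n {} w) = eval_word ?\<Gamma> (pres_gen n {r}) w"
    and \<pi>_gen: "\<And>i. i < n \<Longrightarrow> \<pi> (x i) = pres_gen n {r} i"
    unfolding F_def x_def
    by (rule presented_group_lift [of ?\<Gamma> n "pres_gen n {r}" "{}"])
      (auto simp: \<Gamma> group_presented_group pres_gen_closed)
  interpret \<pi>: group_hom F ?\<Gamma> \<pi> by (rule \<pi>)
  have \<pi>_surj: "\<pi> ` carrier F = carrier ?\<Gamma>"
    unfolding \<Gamma>
  proof (rule subgroup_presented_group_eq_carrier)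
    show "subgroup (\<pi> ` carrier F) (presented_group n {r})"
      using \<pi>.img_is_subgroup by (simp add: \<Gamma>)
    show "pres_gen n {r} i \<in> \<pi> ` carrier F" if "i < n" for i
      using \<pi>_gen [OF that] x [OF that] by (metis imageI)
  qed
  \<comment> \<open>Taking the kernel of \<pi> avoids a separate description of the normal closure;
    the class of r is then shown to belong to it.\<close>
  define R where "R = kernel F ?\<Gamma> \<pi>"
  have \<pi>_ker: "\<pi> y = \<one>\<^bsub>?\<Gamma>\<^esub> \<longleftrightarrow> y \<in> R" if "y \<in> carrier F" for y
    using that by (simp add: R_def kernel_def)
  have R: "R \<lhd> F" unfolding R_def by (rule \<pi>.normal_kernel)
  have R_closed: "s \<in> carrier F" if "s \<in> R" for s
    by (rule subgroup.mem_carrier [OF normal_imp_subgroup [OF R] that])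
  have "\<pi> (word_class n {} r) = \<one>\<^bsub>?\<Gamma>\<^esub>"
    using rl by (simp add: \<pi>_word \<Gamma> eval_word_pres_gen word_class_relator)
  moreover have cF: "word_class n {} r \<in> carrier F"
    using rl by (simp add: F_def carrier_presented_group)
  ultimately have rR: "word_class n {} r \<in> R" by (simp add: R_def kernel_def)

  \<comment> \<open>This is the abelianization of \<Gamma>_g reduced modulo 2, with the generators
    going to a basis.\<close>
  obtain v where v: "group_hom ?\<Gamma> ?V v" "\<And>i. i < n \<Longrightarrow> v (pres_gen n {r} i) = {i}"
    unfolding n_def r_def
    by (rule surface_group_lift [of "parity_group (2 * g)" g "\<lambda>i. {i}"]) (auto simp: group_parity_group)
  interpret v: group_hom ?\<Gamma> ?V v by (rule v)
  interpret v\<pi>: group_hom F ?V "\<lambda>y. v (\<pi> y)" by (rule group_hom_compose [OF \<pi> v(1)])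

  obtain q where q: "group_hom ?\<Gamma> ?Q q" "q ` carrier ?\<Gamma> = carrier ?Q"
    using surface_group_onto_sym_group [OF assms] by blast
  define D where "D = lower_central F (Suc (Suc 0))"
  have Qfin: "finite (carrier ?Q)" by (simp add: sym_group_def finite_permutations)
  interpret prime_surjections F ?Q D
    by (intro prime_surjections.intro prime_surjections_axioms.intro)
      (simp_all add: sym_group_is_group Qfin conj_prime_sym_group D_def F.lower_central_normal)
  \<comment> \<open>A nontrivial element of S_5, from which the nontriviality of every surjection on
    \<gamma>_2(F) is derived.\<close>
  have tau: "Transposition.transpose 1 2 \<in> carrier ?Q" "Transposition.transpose 1 2 \<noteq> \<one>\<^bsub>?Q\<^esub>"
    by (auto simp: sym_group_carrier sym_group_one fun_eq_iff Transposition.transpose_def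
        intro!: permutes_swap_id)
  have adm: "admissible \<rho>" if "group_hom F ?Q \<rho>" "\<rho> ` carrier F = carrier ?Q" for \<rho>
    using conj_prime_derived_not_in_kernel [OF that conj_prime_sym_group tau] that
    unfolding admissible_def by (simp add: D_def)
  define T where "T = {\<rho> \<in> extensional (carrier F). admissible \<rho>}"
  have "finite T"
    by (rule finite_subset [OF _ finite_surjections [OF Qfin, of n "{}", folded F_def]])
      (auto simp: T_def admissible_def)
  obtain w where w: "surface_relator g = [(0, False), (1, False), (0, True), (1, True)] @ w"
    "w \<in> lists (letters n)" "\<And>l. l \<in> set w \<Longrightarrow> 2 \<le> fst l"
    unfolding n_def by (rule surface_relator_split [of g]) (use assms in auto)
  have "\<exists>u. (\<forall>i<n. u i \<in> carrier F \<and> inv\<^bsub>F\<^esub> x i \<otimes>\<^bsub>F\<^esub> u i \<in> D) \<and>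
    (\<forall>\<rho>\<in>T. eval_word ?Q (\<lambda>i. \<rho> (u i)) r \<noteq> \<one>\<^bsub>?Q\<^esub>)"
    unfolding r_def
    by (rule exists_avoiding_words [OF \<open>finite T\<close> _ _ n w(2) _ w(1)]) (use x w(3) in \<open>auto simp: T_def\<close>)
  then obtain u where u: "\<And>i. i < n \<Longrightarrow> u i \<in> carrier F" "\<And>i. i < n \<Longrightarrow> inv\<^bsub>F\<^esub> x i \<otimes>\<^bsub>F\<^esub> u i \<in> D"
    and avoid: "\<And>\<rho>. \<rho> \<in> T \<Longrightarrow> eval_word ?Q (\<lambda>i. \<rho> (u i)) r \<noteq> \<one>\<^bsub>?Q\<^esub>"
    by blast

  obtain \<phi> where \<phi>: "group_hom F F \<phi>"
    and \<phi>_word: "\<And>w. w \<in> lists (letters n) \<Longrightarrow> \<phi> (word_class n {} w) = eval_word F u w"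
    and \<phi>_gen: "\<And>i. i < n \<Longrightarrow> \<phi> (x i) = u i"
    unfolding x_def
    by (rule presented_group_lift [of F n u "{}", folded F_def]) (use u(1) F.is_group in auto)
  have \<phi>_id: "inv\<^bsub>F\<^esub> y \<otimes>\<^bsub>F\<^esub> \<phi> y \<in> lower_central F (Suc (Suc 0))" if "y \<in> carrier F" for y
    using endo_id_if_on_generators [of n "{}" \<phi> D y] \<phi> u(2) \<phi>_gen that F.lower_central_normal
    unfolding F_def x_def D_def by simp
  interpret E: abelian_trivial_endo F \<phi> R
    by (intro abelian_trivial_endo.intro abelian_trivial_endo_axioms.intro \<phi> R \<phi>_id)

  have "countable (carrier F)" by (simp add: F_def carrier_presented_group)
  then obtain G :: "nat monoid" and p where p: "group_hom F G p" "p ` carrier F = carrier G"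
    and p_ker: "\<And>y. y \<in> carrier F \<Longrightarrow> p y = \<one>\<^bsub>G\<^esub> \<longleftrightarrow> y \<in> E.limit"
    using F.countable_quotient_nat [OF _ E.limit_normal] by blast
  interpret p: group_hom F G p by (rule p)

  have "residually_nilpotent G"
    by (rule E.residually_nilpotent_limit_quotient [where G = G and p = p]) (use p p_ker in blast)+
  moreover have "\<forall>i\<ge>1. G Mod lower_central G i \<cong> ?\<Gamma> Mod lower_central ?\<Gamma> i"
  proof (intro allI impI)
    fix i :: nat assume "1 \<le> i"
    then obtain k where "i = Suc k" by (cases i) auto
    have "G Mod lower_central G (Suc k) \<cong> ?\<Gamma> Mod lower_central ?\<Gamma> (Suc k)"
      by (rule E.lower_central_quotient_iso [where p = p and q = \<pi>])
        (rule p p_ker \<pi> \<pi>_surj \<pi>_ker, assumption?)+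
    thus "G Mod lower_central G i \<cong> ?\<Gamma> Mod lower_central ?\<Gamma> i" using \<open>i = Suc k\<close> by simp
  qed
  moreover have "has_rank G n"
  proof -
    \<comment> \<open>The map v \<pi> is to descend to G. It kills \<gamma>_2(F), the target being
      abelian, and it kills \<phi>(R), because \<phi>(s) agrees with s modulo \<gamma>_2(F) and
      \<pi>(s) = 1.\<close>
    have vD: "v (\<pi> d) = \<one>\<^bsub>?V\<^esub>" if "d \<in> D" for d
      using that unfolding D_def by (rule v\<pi>.lower_central_subset_kernel [rotated]) auto
    have vR: "v (\<pi> (\<phi> s)) = \<one>\<^bsub>?V\<^esub>" if "s \<in> R" for s
    proof -
      have s: "s \<in> carrier F" "\<pi> s = \<one>\<^bsub>?\<Gamma>\<^esub>" using R_closed [OF that] \<pi>_ker that by blast+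
      have "v (\<pi> (inv\<^bsub>F\<^esub> s \<otimes>\<^bsub>F\<^esub> \<phi> s)) = \<one>\<^bsub>?V\<^esub>" by (rule vD) (use \<phi>_id [OF s(1)] D_def in simp)
      hence "v (\<pi> s) = v (\<pi> (\<phi> s))" using v\<pi>.hom_eq_iff [of s "\<phi> s"] s(1) by simp
      thus ?thesis using s(2) v.hom_one by simp
    qed
    have v_limit: "v (\<pi> y) = \<one>\<^bsub>?V\<^esub>" if "y \<in> E.limit" for y
    proof -
      \<comment> \<open>The level \<gamma>_2(F) \<phi>(R) already lies in the kernel of v \<pi>, so
        a single term of the intersection suffices.\<close>
      have "y \<in> E.level 1" using that by (simp add: E.limit_def)
      then obtain c s where cs: "c \<in> lower_central F (Suc 1)" "s \<in> R" "y = c \<otimes>\<^bsub>F\<^esub> \<phi> s"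
        by (rule E.levelE)
      have "c \<in> D" using cs(1) by (simp add: D_def)
      moreover have "c \<in> carrier F" "\<phi> s \<in> carrier F"
        using F.lower_central_closed [OF cs(1)] E.hom_closed [OF R_closed [OF cs(2)]] by blast+
      ultimately show ?thesis
        using v\<pi>.hom_mult [of c "\<phi> s"] vD vR [OF cs(2)] cs(3) by simp
    qed
    have v_ker: "v (\<pi> y) = \<one>\<^bsub>?V\<^esub>" if "y \<in> carrier F" "p y = \<one>\<^bsub>G\<^esub>" for y
      using v_limit p_ker [OF that(1)] that(2) by blast
    obtain v' where v': "group_hom G ?V v'" "\<And>y. y \<in> carrier F \<Longrightarrow> v' (p y) = v (\<pi> y)"
      by (rule group_hom_factor [OF p v\<pi>.group_hom_axioms v_ker]) (assumption | blast)+
    have "generate F (x ` {..<n}) = carrier F"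
      unfolding F_def
    proof (rule subgroup_presented_group_eq_carrier)
      show "subgroup (generate (presented_group n {}) (x ` {..<n})) (presented_group n {})"
        using F.generate_is_subgroup [of "x ` {..<n}"] x by (auto simp: F_def)
      show "pres_gen n {} i \<in> generate (presented_group n {}) (x ` {..<n})" if "i < n" for i
        using that by (auto simp: x_def intro: generate.incl)
    qed
    moreover have "x ` {..<n} \<subseteq> carrier F" using x by auto
    ultimately have "generate G ((\<lambda>i. p (x i)) ` {..<n}) = carrier G"
      using p.generate_img [of "x ` {..<n}"] p(2) by (simp add: image_image)
    thus ?thesis
      using x v'(2) \<pi>_gen v(2)
      by (intro has_rankI [of G n "\<lambda>i. p (x i)" v'] v'(1)) auto
  qed
  moreover have "\<not> G \<cong> ?\<Gamma>"
  proof
    assume "G \<cong> ?\<Gamma>"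
    then obtain \<theta> where \<theta>: "\<theta> \<in> hom G ?\<Gamma>" "\<theta> ` carrier G = carrier ?\<Gamma>"
      by (auto simp: is_iso_def iso_def bij_betw_def)
    have "group_hom G ?\<Gamma> \<theta>"
      using \<theta>(1) by (intro group_hom.intro group_hom_axioms.intro) auto
    hence q\<theta>: "group_hom G ?Q (\<lambda>y. q (\<theta> y))" using q(1) by (rule group_hom_compose)
    interpret q\<theta>: group_hom G ?Q "\<lambda>y. q (\<theta> y)" by (rule q\<theta>)
    \<comment> \<open>The restriction makes \<rho> extensional, as membership in T requires.\<close>
    define \<rho> where "\<rho> = restrict (\<lambda>y. q (\<theta> (p y))) (carrier F)"
    have "group_hom F ?Q (\<lambda>y. q (\<theta> (p y)))" using p(1) q\<theta> by (rule group_hom_compose)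
    then interpret s: group_hom F ?Q "\<lambda>y. q (\<theta> (p y))" .
    have "\<rho> \<in> hom F ?Q" by (rule homI) (simp_all add: \<rho>_def)
    hence "group_hom F ?Q \<rho>" by (intro group_hom.intro group_hom_axioms.intro) auto
    moreover have "\<rho> ` carrier F = q ` \<theta> ` p ` carrier F" by (simp add: \<rho>_def image_image)
    hence "\<rho> ` carrier F = carrier ?Q" using p(2) \<theta>(2) q(2) by simp
    ultimately have "\<rho> \<in> T" using adm by (simp add: T_def \<rho>_def)
    hence "eval_word ?Q (\<lambda>i. \<rho> (u i)) r \<noteq> \<one>\<^bsub>?Q\<^esub>" by (rule avoid)
    moreover have "eval_word ?Q (\<lambda>i. \<rho> (u i)) r = eval_word ?Q (\<lambda>i. q (\<theta> (p (u i)))) r"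
    proof (rule eval_word_cong)
      fix l assume "l \<in> set r"
      hence "fst l < n" using rl by (auto simp: letters_def)
      thus "\<rho> (u (fst l)) = q (\<theta> (p (u (fst l))))" using u(1) by (simp add: \<rho>_def)
    qed
    \<comment> \<open>Evaluating r at the images of the u_i is the same as applying the composite to
      \<phi>(r), which lies in \<open>limit\<close> and so dies in G, against the choice of
      u.\<close>
    moreover have "\<dots> = q (\<theta> (p (\<phi> (word_class n {} r))))"
      using s.hom_eval_word [OF u(1) rl] \<phi>_word [OF rl] by simp
    moreover have "p (\<phi> (word_class n {} r)) = \<one>\<^bsub>G\<^esub>"
      using E.image_subset_limit [OF rR] p_ker cF by simp
    ultimately show False using q\<theta>.hom_one by simp
  qed
  ultimately show ?thesis unfolding n_def using p.H.is_group by blast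
qed

end
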